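(* Let $(G,\rho)$ be a recurrent reversible random rooted graph, with $G$ infinite. Then $G$ has the infinite collision property almost surely.
   Context: A rooted graph $(G,\rho)$ is a connected, locally finite (multi)graph $G=(V,E)$ together with a distinguished vertex $\rho\in V$, the root. An isomorphism of rooted graphs is a graph isomorphism mapping root to root. The set of isomorphism classes of rooted graphs is endowed with the local topology, in which, roughly speaking, two (isomorphism classes of) rooted graphs are close to each other if and only if they have large isomorphic balls around their roots. A random rooted graph is a random variable taking values in this space. Similarly, a doubly-rooted graph is a graph together with an ordered pair of distinguished (not necessarily distinct) vertices, and the space of isomorphism classes of doubly-rooted graphs is topologized in the same way. The simple random walk on a locally finite (multi)graph $G=(V,E)$ is the Markov process $\langle X_n\rangle_{n\ge 0}$ on $V$ with transition probabilities $p(u,v)$ equal to the fraction of edges emanating from $u$ that end in $v$. A graph is recurrent if simple random walk on it is recurrent; the random rooted graph $(G,\rho)$ is recurrent if $G$ is recurrent almost surely. A random rooted graph $(G,\rho)$ is reversible if, when $\langle X_n\rangle_{n\ge0}$ is a simple random walk on $G$ started at $\rho$, the doubly-rooted graphs $(G,\rho,X_n)$ and $(G,X_n,\rho)$ have the same distribution for all $n$. An infinite, connected, locally finite graph $G$ has the infinite collision property if for every vertex $v$ of $G$, two independent simple random walks $\langle X_n\rangle_{n\geq 0}$ and $\langle Y_n\rangle_{n\ge 0}$ on $G$ started from $v$ collide (i.e. occupy the same vertex at the same time, $X_n=Y_n$) infinitely often almost surely. *)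

theory Defs
  imports "HOL-Probability.Probability"
begin

section \<open>Multigraphs\<close>

text \<open>
  A connected, locally finite multigraph is countable, so up to isomorphism its vertices and edges
  may be taken in \<^typ>\<open>nat\<close>. An edge is undirected: its set of endpoints is \<open>{u, v}\<close>, which is a
  singleton for a loop. Values of \<open>ends\<close> outside \<open>edges\<close> are irrelevant.
\<close>

record multigraph =
  verts :: "nat set"
  edges :: "nat set"
  ends :: "nat \<Rightarrow> nat set"

definition adj :: "multigraph \<Rightarrow> nat \<Rightarrow> nat \<Rightarrow> bool" where
  "adj G u v \<longleftrightarrow> (\<exists>e\<in>edges G. ends G e = {u, v})"

definition edges_at :: "multigraph \<Rightarrow> nat \<Rightarrow> nat set" where
  "edges_at G u = {e \<in> edges G. u \<in> ends G e}"

definition wf_multigraph :: "multigraph \<Rightarrow> bool" where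
  "wf_multigraph G \<longleftrightarrow> (\<forall>e\<in>edges G. \<exists>u\<in>verts G. \<exists>v\<in>verts G. ends G e = {u, v})"

definition locally_finite :: "multigraph \<Rightarrow> bool" where
  "locally_finite G \<longleftrightarrow> (\<forall>u\<in>verts G. finite (edges_at G u))"

definition connected_graph :: "multigraph \<Rightarrow> bool" where
  "connected_graph G \<longleftrightarrow> verts G \<noteq> {} \<and> (\<forall>u\<in>verts G. \<forall>v\<in>verts G. (adj G)\<^sup>*\<^sup>* u v)"

definition conn_lf_multigraph :: "multigraph \<Rightarrow> bool" where
  "conn_lf_multigraph G \<longleftrightarrow> wf_multigraph G \<and> locally_finite G \<and> connected_graph G"

definition graph_iso :: "(nat \<Rightarrow> nat) \<Rightarrow> (nat \<Rightarrow> nat) \<Rightarrow> multigraph \<Rightarrow> multigraph \<Rightarrow> bool" where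
  "graph_iso f g G H \<longleftrightarrow> bij_betw f (verts G) (verts H) \<and> bij_betw g (edges G) (edges H) \<and>
     (\<forall>e\<in>edges G. ends H (g e) = f ` ends G e)"

definition marked_iso :: "multigraph \<Rightarrow> nat list \<Rightarrow> multigraph \<Rightarrow> nat list \<Rightarrow> bool" where
  "marked_iso G R H S \<longleftrightarrow> (\<exists>f g. graph_iso f g G H \<and> map f R = S)"

text \<open>The vertices at graph distance at most \<open>r\<close> from the set \<open>S\<close>.\<close>

primrec vball :: "multigraph \<Rightarrow> nat set \<Rightarrow> nat \<Rightarrow> nat set" where
  "vball G S 0 = S"
| "vball G S (Suc r) = vball G S r \<union> {v. \<exists>u\<in>vball G S r. adj G u v}"

definition induced :: "multigraph \<Rightarrow> nat set \<Rightarrow> multigraph" where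
  "induced G U = \<lparr>verts = U, edges = {e \<in> edges G. ends G e \<subseteq> U}, ends = ends G\<rparr>"

text \<open>
  For two roots the ball of radius \<open>r\<close> is induced by the union of the balls around both of them; it is
  connected as soon as \<open>2 * r + 1\<close> is at least their distance.
\<close>

definition same_balls :: "nat \<Rightarrow> multigraph \<Rightarrow> nat list \<Rightarrow> multigraph \<Rightarrow> nat list \<Rightarrow> bool" where
  "same_balls r G R H S \<longleftrightarrow>
     marked_iso (induced G (vball G (set R) r)) R (induced H (vball H (set S) r)) S"


section \<open>Simple random walk\<close>

text \<open>
  One step of the walk from \<open>u\<close>: choose a uniformly random edge at \<open>u\<close> and move to its other endpoint
  (to \<open>u\<close> itself for a loop); see \<open>pmf_srw_step\<close> below. A loop counts once among the edges at its
  vertex; the convention that counts it twice is recovered by doubling every loop. If there is no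
  edge at \<open>u\<close>, the walk stays put.
\<close>

definition srw_step :: "multigraph \<Rightarrow> nat \<Rightarrow> nat pmf" where
  "srw_step G u =
     (if edges_at G u = {} then return_pmf u
      else map_pmf (\<lambda>e. THE v. ends G e = {u, v}) (pmf_of_set (edges_at G u)))"

definition srw_kernel :: "multigraph \<Rightarrow> nat \<Rightarrow> nat \<Rightarrow> (nat \<Rightarrow> nat) \<Rightarrow> nat measure" where
  "srw_kernel G v n x = measure_pmf (if n = 0 then return_pmf v else srw_step G (x (n - 1)))"

interpretation srw: Ionescu_Tulcea "srw_kernel G v" "\<lambda>_. count_space UNIV" for G v
proof (rule Ionescu_Tulcea.intro)
  fix i
  show "srw_kernel G v i \<in> PiM {0..<i} (\<lambda>_. count_space UNIV) \<rightarrow>\<^sub>M subprob_algebra (count_space UNIV)"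
  proof (cases i)
    case 0
    then show ?thesis
      by (auto simp: srw_kernel_def[abs_def] intro!: measurable_const
          measure_pmf_in_subprob_algebra)
  next
    case (Suc n)
    have "(\<lambda>x. x n) \<in> PiM {0..<i} (\<lambda>_. count_space (UNIV::nat set)) \<rightarrow>\<^sub>M count_space UNIV"
      by (rule measurable_component_singleton) (simp add: Suc)
    moreover have "(\<lambda>u. measure_pmf (srw_step G u)) \<in> count_space UNIV \<rightarrow>\<^sub>M subprob_algebra (count_space UNIV)"
      by (auto intro: measure_pmf_in_subprob_algebra)
    ultimately show ?thesis
      using measurable_compose[of "\<lambda>x. x n" _ "count_space UNIV" "\<lambda>u. measure_pmf (srw_step G u)"]
      by (simp add: srw_kernel_def[abs_def] Suc)
  qed
next
  fix i x
  show "prob_space (srw_kernel G v i x)"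
    by (simp add: srw_kernel_def prob_space_measure_pmf)
qed

definition srw_law :: "multigraph \<Rightarrow> nat \<Rightarrow> (nat \<Rightarrow> nat) measure" where
  "srw_law G v = srw.PF.lim G v"

definition recurrent_graph :: "multigraph \<Rightarrow> bool" where
  "recurrent_graph G \<longleftrightarrow> (\<forall>v\<in>verts G. AE x in srw_law G v. \<exists>n\<ge>1. x n = v)"

definition collision_graph :: "multigraph \<Rightarrow> bool" where
  "collision_graph G \<longleftrightarrow>
     (\<forall>v\<in>verts G. AE (x, y) in srw_law G v \<Otimes>\<^sub>M srw_law G v. \<exists>\<^sub>\<infinity>n. x n = y n)"


lemma pmf_srw_step:
  assumes "wf_multigraph G" "locally_finite G" "u \<in> verts G" "edges_at G u \<noteq> {}"
  shows "pmf (srw_step G u) v = card {e \<in> edges G. ends G e = {u, v}} / card (edges_at G u)"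
proof -
  have fin: "finite (edges_at G u)"
    using assms by (simp add: locally_finite_def)
  have other: "(THE w. ends G e = {u, w}) = v \<longleftrightarrow> ends G e = {u, v}" if e: "e \<in> edges_at G u" for e
  proof -
    obtain w where w: "ends G e = {u, w}"
      using e assms(1) by (fastforce simp: edges_at_def wf_multigraph_def)
    then have "(THE w. ends G e = {u, w}) = w"
      by (intro the_equality) (auto simp: doubleton_eq_iff)
    with w show ?thesis by (auto simp: doubleton_eq_iff)
  qed
  have "edges_at G u \<inter> (\<lambda>e. THE w. ends G e = {u, w}) -` {v} = {e \<in> edges G. ends G e = {u, v}}"
    using other by (auto simp: edges_at_def)
  then show ?thesis
    using assms(4) fin
    by (simp add: srw_step_def pmf_map measure_pmf_of_set)
qed


section \<open>Invariance under isomorphism\<close>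

lemma graph_iso_refl: "graph_iso id id G G"
  by (simp add: graph_iso_def)

lemma graph_iso_trans:
  assumes "graph_iso f g G H" "graph_iso f' g' H K"
  shows "graph_iso (f' \<circ> f) (g' \<circ> g) G K"
  using assms unfolding graph_iso_def
  by (auto intro: bij_betw_trans simp: image_comp dest: bij_betwE)

lemma graph_iso_sym:
  assumes iso: "graph_iso f g G H" and wf: "wf_multigraph G"
  shows "graph_iso (inv_into (verts G) f) (inv_into (edges G) g) H G"
  unfolding graph_iso_def
proof (intro conjI ballI)
  have f: "bij_betw f (verts G) (verts H)" and g: "bij_betw g (edges G) (edges H)"
    and fg: "\<And>e. e \<in> edges G \<Longrightarrow> ends H (g e) = f ` ends G e"
    using iso by (auto simp: graph_iso_def)
  show "bij_betw (inv_into (verts G) f) (verts H) (verts G)"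
    using f by (rule bij_betw_inv_into)
  show "bij_betw (inv_into (edges G) g) (edges H) (edges G)"
    using g by (rule bij_betw_inv_into)
  fix e assume "e \<in> edges H"
  then obtain d where d: "d \<in> edges G" "e = g d"
    using g by (auto simp: bij_betw_def)
  have "ends G d \<subseteq> verts G"
    using wf d(1) by (fastforce simp: wf_multigraph_def)
  then have "inv_into (verts G) f ` f ` ends G d = ends G d"
    using f by (intro inv_into_image_cancel) (auto simp: bij_betw_def)
  moreover have "inv_into (edges G) g e = d"
    using g d by (simp add: bij_betw_def)
  ultimately show "ends G (inv_into (edges G) g e) = inv_into (verts G) f ` ends H e"
    using fg[OF d(1)] d(2) by simp
qed

lemma marked_iso_refl: "marked_iso G R G R"
  using graph_iso_refl by (fastforce simp: marked_iso_def)

lemma marked_iso_trans: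
  "marked_iso G R H S \<Longrightarrow> marked_iso H S K T \<Longrightarrow> marked_iso G R K T"
  unfolding marked_iso_def by (metis graph_iso_trans map_map)

lemma marked_iso_sym:
  assumes "marked_iso G R H S" "wf_multigraph G" "set R \<subseteq> verts G"
  shows "marked_iso H S G R"
proof -
  obtain f g where fg: "graph_iso f g G H" "map f R = S"
    using assms(1) by (auto simp: marked_iso_def)
  have "inj_on f (verts G)"
    using fg(1) by (auto simp: graph_iso_def bij_betw_def)
  then have "inv_into (verts G) f (f x) = x" if "x \<in> set R" for x
    using assms(3) that by (intro inv_into_f_f) auto
  then have "map (inv_into (verts G) f) S = R"
    unfolding fg(2)[symmetric] map_map by (intro map_idI) simp
  then show ?thesis
    using graph_iso_sym[OF fg(1) assms(2)] by (auto simp: marked_iso_def)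
qed

lemma wf_induced: "wf_multigraph G \<Longrightarrow> wf_multigraph (induced G U)"
  by (fastforce simp: wf_multigraph_def induced_def)

lemma vball_subset: "wf_multigraph G \<Longrightarrow> S \<subseteq> verts G \<Longrightarrow> vball G S r \<subseteq> verts G"
  by (induction r) (fastforce simp: adj_def wf_multigraph_def doubleton_eq_iff)+

lemma subset_vball: "S \<subseteq> vball G S r"
  by (induction r) auto

lemma adj_iso:
  assumes iso: "graph_iso f g G H" and wf: "wf_multigraph G" and u: "u \<in> verts G"
  shows "adj H (f u) w \<longleftrightarrow> (\<exists>v\<in>verts G. w = f v \<and> adj G u v)"
proof
  have f: "inj_on f (verts G)" and g: "g ` edges G = edges H"
    and fg: "\<And>e. e \<in> edges G \<Longrightarrow> ends H (g e) = f ` ends G e"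
    using iso by (auto simp: graph_iso_def bij_betw_def)
  {
    assume "adj H (f u) w"
    then obtain d where "d \<in> edges H" "ends H d = {f u, w}"
      by (auto simp: adj_def)
    then obtain e where e: "e \<in> edges G" "f ` ends G e = {f u, w}"
      using g fg by (metis imageE)
    obtain a b where ab: "a \<in> verts G" "b \<in> verts G" "ends G e = {a, b}"
      using wf e(1) by (auto simp: wf_multigraph_def)
    then have "f a = f u \<and> w = f b \<or> f b = f u \<and> w = f a"
      using e(2) by (auto simp: doubleton_eq_iff)
    then have "a = u \<and> w = f b \<or> b = u \<and> w = f a"
      using inj_on_eq_iff[OF f ab(1) u] inj_on_eq_iff[OF f ab(2) u] by blast
    then show "\<exists>v\<in>verts G. w = f v \<and> adj G u v"
    proof (elim disjE conjE)
      assume "a = u" "w = f b"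
      then show ?thesis
        using ab e(1) by (auto simp: adj_def)
    next
      assume "b = u" "w = f a"
      then show ?thesis
        using ab e(1) by (auto simp: adj_def insert_commute)
    qed
  }
  assume "\<exists>v\<in>verts G. w = f v \<and> adj G u v"
  then obtain e v where "e \<in> edges G" "ends G e = {u, v}" "w = f v"
    by (auto simp: adj_def)
  then show "adj H (f u) w"
    using g fg by (auto simp: adj_def intro!: bexI[of _ "g e"])
qed

lemma vball_iso:
  assumes "graph_iso f g G H" "wf_multigraph G" "S \<subseteq> verts G"
  shows "vball H (f ` S) r = f ` vball G S r"
proof (induction r)
  case (Suc r)
  have sub: "vball G S r \<subseteq> verts G"
    using assms by (intro vball_subset)
  have adj: "v \<in> verts G" if "adj G u v" for u v
    using that assms(2) by (fastforce simp: adj_def wf_multigraph_def doubleton_eq_iff)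
  have "(\<exists>u\<in>f ` vball G S r. adj H u w) \<longleftrightarrow> (\<exists>v. (\<exists>u\<in>vball G S r. adj G u v) \<and> w = f v)" for w
    using adj_iso[OF assms(1,2) subsetD[OF sub]] adj by blast
  then have "{w. \<exists>u\<in>f ` vball G S r. adj H u w} = f ` {v. \<exists>u\<in>vball G S r. adj G u v}"
    by (simp add: image_def conj_commute)
  then show ?case
    by (simp add: Suc image_Un)
qed simp

lemma marked_iso_vball:
  assumes "marked_iso G R H S" "wf_multigraph G" "set R \<subseteq> verts G"
  shows "same_balls r G R H S"
proof -
  obtain f g where fg: "graph_iso f g G H" "map f R = S"
    using assms(1) by (auto simp: marked_iso_def)
  define U where "U = vball G (set R) r"
  have U: "U \<subseteq> verts G"
    unfolding U_def using assms by (intro vball_subset)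
  have ball: "vball H (set S) r = f ` U"
    using vball_iso[OF fg(1) assms(2,3)] fg(2) by (auto simp: U_def)
  have f: "inj_on f (verts G)" and g: "inj_on g (edges G)" "g ` edges G = edges H"
    and ends: "\<And>e. e \<in> edges G \<Longrightarrow> ends H (g e) = f ` ends G e"
    using fg by (auto simp: graph_iso_def bij_betw_def)
  have sub: "f ` ends G e \<subseteq> f ` U \<longleftrightarrow> ends G e \<subseteq> U" if "e \<in> edges G" for e
    using that assms(2) U f by (intro inj_on_image_subset_iff) (fastforce simp: wf_multigraph_def)+
  have "graph_iso f g (induced G U) (induced H (f ` U))"
    unfolding graph_iso_def
  proof (intro conjI)
    show "bij_betw f (verts (induced G U)) (verts (induced H (f ` U)))"
      using f U by (auto simp: induced_def bij_betw_def intro: inj_on_subset)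
    have "{e \<in> edges H. ends H e \<subseteq> f ` U} = g ` {e \<in> edges G. ends H (g e) \<subseteq> f ` U}"
      by (auto simp flip: g(2))
    also have "{e \<in> edges G. ends H (g e) \<subseteq> f ` U} = {e \<in> edges G. ends G e \<subseteq> U}"
      by (intro Collect_cong conj_cong refl) (simp only: sub ends)
    finally have "{e \<in> edges H. ends H e \<subseteq> f ` U} = g ` {e \<in> edges G. ends G e \<subseteq> U}" .
    then show "bij_betw g (edges (induced G U)) (edges (induced H (f ` U)))"
      using g(1) by (auto simp: induced_def bij_betw_def intro: inj_on_subset)
    show "\<forall>e\<in>edges (induced G U). ends (induced H (f ` U)) (g e) = f ` ends (induced G U) e"
      using ends by (auto simp: induced_def)
  qed
  then show ?thesis
    using fg(2) by (auto simp: same_balls_def marked_iso_def ball U_def)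
qed

lemma same_balls_sym:
  "same_balls r G R H S \<Longrightarrow> wf_multigraph G \<Longrightarrow> same_balls r H S G R"
  unfolding same_balls_def
  by (rule marked_iso_sym) (auto simp: wf_induced, auto simp: induced_def intro: subsetD[OF subset_vball])

lemma same_balls_trans:
  "same_balls r G R H S \<Longrightarrow> same_balls r H S K T \<Longrightarrow> same_balls r G R K T"
  unfolding same_balls_def by (rule marked_iso_trans)

lemma same_balls_cong:
  assumes "marked_iso G R G' R'" "wf_multigraph G" "set R \<subseteq> verts G"
    and "marked_iso H S H' S'" "wf_multigraph H" "set S \<subseteq> verts H"
    and "wf_multigraph G'"
  shows "same_balls r G R H S \<longleftrightarrow> same_balls r G' R' H' S'"
  by (meson assms marked_iso_vball same_balls_sym same_balls_trans)

lemma srw_step_iso: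
  assumes iso: "graph_iso f g G H" and wf: "wf_multigraph G" and u: "u \<in> verts G"
    and fin: "finite (edges_at G u)"
  shows "srw_step H (f u) = map_pmf f (srw_step G u)"
proof -
  have f: "inj_on f (verts G)" and g: "inj_on g (edges G)" "g ` edges G = edges H"
    and fg: "\<And>e. e \<in> edges G \<Longrightarrow> ends H (g e) = f ` ends G e"
    using iso by (auto simp: graph_iso_def bij_betw_def)
  have sub: "ends G e \<subseteq> verts G" if "e \<in> edges G" for e
    using wf that by (fastforce simp: wf_multigraph_def)
  have mem: "f u \<in> f ` ends G e \<longleftrightarrow> u \<in> ends G e" if "e \<in> edges G" for e
    using f u sub[OF that] by (rule inj_on_image_mem_iff)
  have at: "edges_at H (f u) = g ` edges_at G u"
    using fg mem by (auto simp: edges_at_def simp flip: g(2))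
  show ?thesis
  proof (cases "edges_at G u = {}")
    case True
    then show ?thesis by (simp add: srw_step_def at)
  next
    case False
    have inj: "inj_on g (edges_at G u)"
      using g(1) by (rule inj_on_subset) (auto simp: edges_at_def)
    have other: "(THE w. ends H (g e) = {f u, w}) = f (THE v. ends G e = {u, v})"
      if e: "e \<in> edges_at G u" for e
    proof -
      obtain v where v: "ends G e = {u, v}"
        using e wf by (fastforce simp: edges_at_def wf_multigraph_def)
      then have "(THE v. ends G e = {u, v}) = v"
        by (intro the_equality) (auto simp: doubleton_eq_iff)
      moreover have "(THE w. ends H (g e) = {f u, w}) = f v"
        using e fg v by (intro the_equality) (auto simp: doubleton_eq_iff edges_at_def)
      ultimately show ?thesis by simp
    qed
    have "pmf_of_set (edges_at H (f u)) = map_pmf g (pmf_of_set (edges_at G u))"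
      unfolding at by (rule map_pmf_of_set_inj[OF inj False fin, symmetric])
    moreover have "map_pmf (\<lambda>e. THE w. ends H (g e) = {f u, w}) (pmf_of_set (edges_at G u)) =
        map_pmf (\<lambda>e. f (THE v. ends G e = {u, v})) (pmf_of_set (edges_at G u))"
      using other False fin by (intro map_pmf_cong) simp_all
    ultimately show ?thesis
      using False by (simp add: srw_step_def at pmf.map_comp o_def)
  qed
qed

lemma set_srw_step:
  assumes "wf_multigraph G" "u \<in> verts G" "finite (edges_at G u)"
  shows "set_pmf (srw_step G u) \<subseteq> verts G"
proof -
  have "(THE v. ends G e = {u, v}) \<in> verts G" if e: "e \<in> edges_at G u" for e
  proof -
    obtain v where v: "ends G e = {u, v}" "v \<in> verts G"
      using e assms(1) by (fastforce simp: edges_at_def wf_multigraph_def)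
    then have "(THE v. ends G e = {u, v}) = v"
      by (intro the_equality) (auto simp: doubleton_eq_iff)
    then show ?thesis using v by simp
  qed
  then show ?thesis
    using assms by (auto simp: srw_step_def)
qed

text \<open>
  The law of the first \<open>n\<close> positions of the walk; \<open>distr_srw_prefix\<close> shows that these are the
  finite-dimensional distributions of \<^const>\<open>srw_law\<close>.
\<close>

primrec srw_prefix :: "multigraph \<Rightarrow> nat \<Rightarrow> nat \<Rightarrow> nat list pmf" where
  "srw_prefix G v 0 = return_pmf []"
| "srw_prefix G v (Suc n) =
     bind_pmf (srw_prefix G v n) (\<lambda>xs. map_pmf (\<lambda>y. xs @ [y])
       (if n = 0 then return_pmf v else srw_step G (last xs)))"

lemma set_srw_prefix:
  assumes "wf_multigraph G" "locally_finite G" "v \<in> verts G" "xs \<in> set_pmf (srw_prefix G v n)"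
  shows "length xs = n \<and> set xs \<subseteq> verts G"
  using assms(4)
proof (induction n arbitrary: xs)
  case (Suc n)
  then obtain ys y where ys: "ys \<in> set_pmf (srw_prefix G v n)" "xs = ys @ [y]"
    and y: "y \<in> set_pmf (if n = 0 then return_pmf v else srw_step G (last ys))"
    by auto
  have len: "length ys = n" "set ys \<subseteq> verts G"
    using Suc.IH[OF ys(1)] by auto
  have "y \<in> verts G"
  proof (cases n)
    case 0
    then show ?thesis using y assms by simp
  next
    case (Suc m)
    then have "last ys \<in> verts G"
      using len last_in_set[of ys] by fastforce
    then show ?thesis
      using y Suc set_srw_step[OF assms(1)] assms(2) by (auto simp: locally_finite_def)
  qed
  then show ?case using len ys by simp
qed simp

lemma srw_prefix_iso:
  assumes iso: "graph_iso f g G H" and G: "wf_multigraph G" "locally_finite G" and v: "v \<in> verts G"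
  shows "srw_prefix H (f v) n = map_pmf (map f) (srw_prefix G v n)"
proof (induction n)
  case (Suc n)
  have step: "(if n = 0 then return_pmf (f v) else srw_step H (last (map f xs))) =
      map_pmf f (if n = 0 then return_pmf v else srw_step G (last xs))"
    if "xs \<in> set_pmf (srw_prefix G v n)" for xs
  proof (cases n)
    case (Suc m)
    then have "xs \<noteq> []" "last xs \<in> verts G"
      using set_srw_prefix[OF G v that] last_in_set[of xs] by fastforce+
    then show ?thesis
      using Suc srw_step_iso[OF iso G(1)] G(2) by (simp add: last_map locally_finite_def)
  qed simp
  let ?p = "\<lambda>xs. if n = 0 then return_pmf v else srw_step G (last xs)"
  have "srw_prefix H (f v) (Suc n) = bind_pmf (srw_prefix G v n) (\<lambda>xs. map_pmf (\<lambda>y. map f xs @ [y])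
      (if n = 0 then return_pmf (f v) else srw_step H (last (map f xs))))"
    by (simp only: srw_prefix.simps Suc bind_map_pmf)
  also have "\<dots> = bind_pmf (srw_prefix G v n) (\<lambda>xs. map_pmf (\<lambda>y. map f xs @ [y]) (map_pmf f (?p xs)))"
    by (intro bind_pmf_cong refl) (simp only: step)
  also have "\<dots> = map_pmf (map f) (srw_prefix G v (Suc n))"
    by (simp only: srw_prefix.simps map_bind_pmf pmf.map_comp o_def map_append list.map)
  finally show ?case .
qed simp

abbreviation traj :: "(nat \<Rightarrow> nat) measure" where
  "traj \<equiv> PiM UNIV (\<lambda>_. count_space UNIV)"

lemma sets_srw_law [measurable_cong, simp]: "sets (srw_law G v) = sets traj"
  by (simp add: srw_law_def)

lemma space_srw_law [simp]: "space (srw_law G v) = UNIV"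
  using sets_eq_imp_space_eq[OF sets_srw_law] by (simp add: space_PiM)

lemma prob_space_srw_law: "prob_space (srw_law G v)"
proof
  let ?X = "space (PiM {} (\<lambda>_::nat. count_space (UNIV::nat set)))"
  interpret C: prob_space "srw.CI G v {}"
    by (rule srw.PF.prob_space_P) auto
  have "emeasure (srw_law G v) (prod_emb UNIV (\<lambda>_. count_space UNIV) {} ?X) = emeasure (srw.CI G v {}) ?X"
    unfolding srw_law_def by (rule srw.lim) auto
  also have "\<dots> = 1"
    using C.emeasure_space_1 by (simp add: srw.CI_def)
  also have "prod_emb UNIV (\<lambda>_. count_space UNIV) {} ?X = (UNIV :: (nat \<Rightarrow> nat) set)"
    by (auto simp: prod_emb_def space_PiM)
  finally show "emeasure (srw_law G v) (space (srw_law G v)) = 1" by simp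
qed

lemma measurable_prefix:
  assumes "{0..<n} \<subseteq> J"
  shows "(\<lambda>x. map x [0..<n]) \<in> PiM J (\<lambda>_. count_space (UNIV :: nat set)) \<rightarrow>\<^sub>M count_space UNIV"
  using assms
proof (induction n)
  case (Suc n)
  have x: "(\<lambda>x. x n) \<in> PiM J (\<lambda>_. count_space (UNIV :: nat set)) \<rightarrow>\<^sub>M count_space UNIV"
    using Suc.prems by (intro measurable_component_singleton) auto
  have "{0..<n} \<subseteq> J"
    using Suc.prems by auto
  then have xs: "(\<lambda>x. map x [0..<n]) \<in> PiM J (\<lambda>_. count_space (UNIV :: nat set)) \<rightarrow>\<^sub>M count_space UNIV"
    by (rule Suc.IH)
  have "(\<lambda>x. xs @ [x n]) \<in> PiM J (\<lambda>_. count_space (UNIV :: nat set)) \<rightarrow>\<^sub>M count_space UNIV" for xs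
    by (rule measurable_compose[OF x, of "\<lambda>y. xs @ [y]"]) simp
  from measurable_compose_countable[where f="\<lambda>xs x. xs @ [x n]", OF this xs]
  show ?case by simp
qed simp

lemma distr_C_prefix:
  "distr (srw.C G v 0 n (\<lambda>_. undefined)) (count_space UNIV) (\<lambda>x. map x [0..<n]) =
     measure_pmf (srw_prefix G v n)"
proof (induction n)
  case 0
  show ?case
    by (simp add: return_pmf.rep_eq distr_return space_PiM)
next
  case (Suc n)
  let ?N = "\<lambda>n. PiM {0..<n} (\<lambda>_. count_space (UNIV :: nat set))"
  let ?C = "srw.C G v 0 n (\<lambda>_. undefined)"
  define F where "F xs = map_pmf (\<lambda>y. xs @ [y]) (if n = 0 then return_pmf v else srw_step G (last xs))"
    for xs
  have init: "(\<lambda>_. undefined) \<in> space (?N 0)"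
    by (auto simp: space_PiM)
  have sets_C: "sets ?C = sets (?N n)"
    using srw.sets_C[OF init] by simp
  have space_C: "space ?C = space (?N n)"
    using sets_C by (rule sets_eq_imp_space_eq)
  have ne: "space ?C \<noteq> {}"
    by (simp add: space_C space_PiM PiE_eq_empty_iff)
  have eP: "srw.eP G v n \<in> ?C \<rightarrow>\<^sub>M subprob_algebra (?N (Suc n))"
    using srw.measurable_eP by (simp add: measurable_cong_sets[OF sets_C])
  have "distr (srw.C G v 0 (Suc n) (\<lambda>_. undefined)) (count_space UNIV) (\<lambda>x. map x [0..<Suc n]) =
      ?C \<bind> (\<lambda>\<omega>. distr (srw.eP G v n \<omega>) (count_space UNIV) (\<lambda>x. map x [0..<Suc n]))"
    using distr_bind[OF eP ne measurable_prefix[of "Suc n"]] by simp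
  also have "\<dots> = ?C \<bind> (\<lambda>\<omega>. measure_pmf (F (map \<omega> [0..<n])))"
  proof (rule bind_cong[OF refl])
    fix \<omega> assume "\<omega> \<in> space ?C"
    then have \<omega>: "\<omega> \<in> space (?N n)" by (simp add: space_C)
    have last: "last (map \<omega> [0..<n]) = \<omega> (n - 1)" if "n \<noteq> 0"
      using that by (cases n) auto
    have "distr (srw.eP G v n \<omega>) (count_space UNIV) (\<lambda>x. map x [0..<Suc n]) =
        distr (srw_kernel G v n \<omega>) (count_space UNIV) ((\<lambda>x. map x [0..<Suc n]) \<circ> fun_upd \<omega> n)"
      unfolding srw.eP_def
      using \<omega> by (intro distr_distr measurable_prefix) (auto simp: srw_kernel_def space_PiM PiE_iff extensional_def)
    also have "\<dots> = distr (srw_kernel G v n \<omega>) (count_space UNIV) (\<lambda>y. map \<omega> [0..<n] @ [y])"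
      by (intro distr_cong) auto
    also have "\<dots> = measure_pmf (F (map \<omega> [0..<n]))"
      using last by (auto simp: F_def srw_kernel_def map_pmf_rep_eq)
    finally show "distr (srw.eP G v n \<omega>) (count_space UNIV) (\<lambda>x. map x [0..<Suc n]) =
        measure_pmf (F (map \<omega> [0..<n]))" .
  qed
  also have "\<dots> = distr ?C (count_space UNIV) (\<lambda>x. map x [0..<n]) \<bind> (\<lambda>xs. measure_pmf (F xs))"
  proof (rule bind_distr[symmetric])
    show "(\<lambda>x. map x [0..<n]) \<in> ?C \<rightarrow>\<^sub>M count_space UNIV"
      unfolding measurable_cong_sets[OF sets_C refl] by (rule measurable_prefix) simp
    show "(\<lambda>xs. measure_pmf (F xs)) \<in> count_space UNIV \<rightarrow>\<^sub>M subprob_algebra (count_space UNIV)"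
      by (simp add: measure_pmf_in_subprob_algebra)
  qed (rule ne)
  also have "\<dots> = measure_pmf (srw_prefix G v (Suc n))"
    by (simp add: Suc measure_pmf_bind F_def[abs_def])
  finally show ?case .
qed

lemma distr_srw_prefix:
  "distr (srw_law G v) (count_space UNIV) (\<lambda>x. map x [0..<n]) = measure_pmf (srw_prefix G v n)"
proof -
  let ?N = "PiM {0..<n} (\<lambda>_. count_space (UNIV :: nat set))"
  have up: "srw.up_to {0..<n} = n"
    by (metis finite_atLeastLessThan srw.up_to_iff_Ico order_antisym ivl_subset le0 order_refl)
  have sets_C: "sets (srw.C G v 0 n (\<lambda>_. undefined)) = sets ?N"
    using srw.sets_C[of "\<lambda>_. undefined" 0 G v n] by (simp add: space_PiM)
  have m: "(\<lambda>x. restrict x {0..<n}) \<in> srw_law G v \<rightarrow>\<^sub>M ?N"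
    unfolding measurable_cong_sets[OF sets_srw_law refl]
    by (rule measurable_restrict_subset) auto
  have "distr (srw_law G v) (count_space UNIV) (\<lambda>x. map x [0..<n]) =
      distr (srw_law G v) (count_space UNIV) ((\<lambda>x. map x [0..<n]) \<circ> (\<lambda>x. restrict x {0..<n}))"
    by (intro distr_cong) auto
  also have "\<dots> = distr (srw.CI G v {0..<n}) (count_space UNIV) (\<lambda>x. map x [0..<n])"
    unfolding srw.distr_lim[OF finite_atLeastLessThan, of G v 0 n, symmetric] srw_law_def[symmetric]
    by (intro distr_distr[symmetric] m measurable_prefix order_refl)
  also have "\<dots> = distr (srw.C G v 0 n (\<lambda>_. undefined)) (count_space UNIV)
      ((\<lambda>x. map x [0..<n]) \<circ> (\<lambda>x. restrict x {0..<n}))"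
    unfolding srw.CI_def up
    by (intro distr_distr measurable_prefix order_refl)
       (simp add: measurable_cong_sets[OF sets_C] measurable_restrict_subset)
  also have "\<dots> = distr (srw.C G v 0 n (\<lambda>_. undefined)) (count_space UNIV) (\<lambda>x. map x [0..<n])"
    by (intro distr_cong) auto
  finally show ?thesis
    by (simp add: distr_C_prefix)
qed

lemma AE_srw_in_verts:
  assumes "wf_multigraph G" "locally_finite G" "v \<in> verts G"
  shows "AE x in srw_law G v. \<forall>n. x n \<in> verts G"
proof (subst AE_all_countable, rule allI)
  fix n
  have m: "(\<lambda>x. map x [0..<Suc n]) \<in> srw_law G v \<rightarrow>\<^sub>M count_space UNIV"
    unfolding measurable_cong_sets[OF sets_srw_law refl] by (rule measurable_prefix) simp
  have "AE xs in srw_prefix G v (Suc n). set xs \<subseteq> verts G"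
    using set_srw_prefix[OF assms] by (simp add: AE_measure_pmf_iff del: srw_prefix.simps)
  then have "AE x in srw_law G v. set (map x [0..<Suc n]) \<subseteq> verts G"
    unfolding distr_srw_prefix[symmetric] by (subst (asm) AE_distr_iff[OF m]) auto
  then show "AE x in srw_law G v. x n \<in> verts G"
    by eventually_elim auto
qed

lemma traj_measure_eqI:
  assumes sets: "sets P = sets traj" "sets Q = sets traj" and "finite_measure P"
    and eq: "\<And>n. distr P (count_space UNIV) (\<lambda>x. map x [0..<n]) =
                   distr Q (count_space UNIV) (\<lambda>x. map x [0..<n])"
  shows "P = Q"
proof (rule measure_eqI_PiM_infinite[OF sets])
  fix J :: "nat set" and A :: "nat \<Rightarrow> nat set" assume J: "finite J"
  obtain n where n: "J \<subseteq> {0..<n}"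
    using J by (metis finite_nat_iff_bounded lessThan_atLeast0)
  define L where "L = {xs. length xs = n \<and> (\<forall>j\<in>J. xs ! j \<in> A j)}"
  let ?E = "prod_emb UNIV (\<lambda>_. count_space UNIV) J (Pi\<^sub>E J A)"
  have E: "?E = (\<lambda>x. map x [0..<n]) -` L \<inter> space traj"
    using n by (auto simp: prod_emb_def L_def space_PiM PiE_iff subset_iff)
  have "emeasure M ?E = emeasure (distr M (count_space UNIV) (\<lambda>x. map x [0..<n])) L"
    if M: "sets M = sets traj" for M
  proof -
    have "(\<lambda>x. map x [0..<n]) \<in> M \<rightarrow>\<^sub>M count_space UNIV"
      unfolding measurable_cong_sets[OF M refl] by (rule measurable_prefix) simp
    then show ?thesis
      by (subst emeasure_distr) (simp_all add: E sets_eq_imp_space_eq[OF M])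
  qed
  then show "emeasure P ?E = emeasure Q ?E"
    using sets eq by metis
qed (use assms in \<open>auto simp: finite_measure_def\<close>)

lemma measurable_traj_map: "(\<lambda>x n. f (x n)) \<in> traj \<rightarrow>\<^sub>M traj"
  by (rule measurable_PiM_single') (auto intro: measurable_compose[OF measurable_component_singleton])

lemma srw_law_iso:
  assumes iso: "graph_iso f g G H" and G: "wf_multigraph G" "locally_finite G" "v \<in> verts G"
  shows "srw_law H (f v) = distr (srw_law G v) traj (\<lambda>x n. f (x n))"
proof (rule traj_measure_eqI)
  interpret prob_space "srw_law H (f v)" by (rule prob_space_srw_law)
  show "finite_measure (srw_law H (f v))" by unfold_locales
  fix n
  have m: "(\<lambda>x n. f (x n)) \<in> srw_law G v \<rightarrow>\<^sub>M traj"
    using measurable_traj_map by (simp add: measurable_cong_sets[OF sets_srw_law refl])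
  have p: "(\<lambda>x. map x [0..<n]) \<in> srw_law G v \<rightarrow>\<^sub>M count_space UNIV"
    using measurable_prefix[of n UNIV] by (simp add: measurable_cong_sets[OF sets_srw_law refl])
  have "distr (srw_law H (f v)) (count_space UNIV) (\<lambda>x. map x [0..<n]) =
      distr (srw_prefix G v n) (count_space UNIV) (map f)"
    by (simp add: distr_srw_prefix srw_prefix_iso[OF iso G] map_pmf_rep_eq)
  also have "\<dots> = distr (srw_law G v) (count_space UNIV) (map f \<circ> (\<lambda>x. map x [0..<n]))"
    unfolding distr_srw_prefix[symmetric] by (rule distr_distr) (auto intro: p)
  also have "\<dots> = distr (srw_law G v) (count_space UNIV) ((\<lambda>x. map x [0..<n]) \<circ> (\<lambda>x n. f (x n)))"
    by (simp add: o_def)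
  also have "\<dots> = distr (distr (srw_law G v) traj (\<lambda>x n. f (x n))) (count_space UNIV) (\<lambda>x. map x [0..<n])"
    by (rule distr_distr[symmetric]) (auto intro: m measurable_prefix)
  finally show "distr (srw_law H (f v)) (count_space UNIV) (\<lambda>x. map x [0..<n]) = \<dots>" .
qed simp_all

lemma recurrent_graph_iso:
  assumes iso: "graph_iso f g G H" and G: "wf_multigraph G" "locally_finite G"
    and rec: "recurrent_graph G"
  shows "recurrent_graph H"
  unfolding recurrent_graph_def
proof
  fix w assume "w \<in> verts H"
  then obtain v where v: "v \<in> verts G" "w = f v"
    using iso bij_betw_imp_surj_on[of f] by (fastforce simp: graph_iso_def)
  have m: "(\<lambda>x n. f (x n)) \<in> srw_law G v \<rightarrow>\<^sub>M traj"
    using measurable_traj_map by (simp add: measurable_cong_sets[OF sets_srw_law refl])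
  have "AE x in srw_law G v. \<exists>n\<ge>1. x n = v"
    using rec v by (simp add: recurrent_graph_def)
  then have "AE x in srw_law G v. \<exists>n\<ge>1. f (x n) = f v"
    by eventually_elim auto
  then show "AE y in srw_law H w. \<exists>n\<ge>1. y n = w"
    unfolding v(2) srw_law_iso[OF iso G v(1)] by (subst AE_distr_iff[OF m]) simp_all
qed

lemma collision_graph_iso:
  assumes iso: "graph_iso f g G H" and G: "wf_multigraph G" "locally_finite G"
    and coll: "collision_graph G"
  shows "collision_graph H"
  unfolding collision_graph_def
proof
  fix w assume "w \<in> verts H"
  then obtain v where v: "v \<in> verts G" "w = f v"
    using iso bij_betw_imp_surj_on[of f] by (fastforce simp: graph_iso_def)
  interpret prob_space "srw_law G v" by (rule prob_space_srw_law)
  let ?F = "\<lambda>x n. f (x n)"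
  have m: "?F \<in> srw_law G v \<rightarrow>\<^sub>M traj"
    using measurable_traj_map by (simp add: measurable_cong_sets[OF sets_srw_law refl])
  interpret D: prob_space "distr (srw_law G v) traj ?F"
    using m by (rule prob_space_distr)
  have prod: "srw_law H w \<Otimes>\<^sub>M srw_law H w =
      distr (srw_law G v \<Otimes>\<^sub>M srw_law G v) (traj \<Otimes>\<^sub>M traj) (\<lambda>(x, y). (?F x, ?F y))"
    unfolding v(2) srw_law_iso[OF iso G v(1)]
    by (rule pair_measure_distr[OF m m]) unfold_locales
  have m2: "(\<lambda>(x, y). (?F x, ?F y)) \<in> srw_law G v \<Otimes>\<^sub>M srw_law G v \<rightarrow>\<^sub>M traj \<Otimes>\<^sub>M traj"
    using m by measurable
  have collide: "(\<lambda>p. fst p n = snd p n) \<in> traj \<Otimes>\<^sub>M traj \<rightarrow>\<^sub>M count_space UNIV" for n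
  proof -
    have x: "(\<lambda>x. x n) \<in> traj \<rightarrow>\<^sub>M count_space UNIV"
      by (rule measurable_component_singleton) simp
    have "(\<lambda>p. \<exists>k. snd p n = k \<and> fst p n = k) \<in> traj \<Otimes>\<^sub>M traj \<rightarrow>\<^sub>M count_space UNIV"
      by (intro pred_intros_countable pred_intros_logic pred_count_space_const1
            measurable_compose[OF measurable_fst x] measurable_compose[OF measurable_snd x])
    then show ?thesis by simp
  qed
  have "Measurable.pred (traj \<Otimes>\<^sub>M traj) (\<lambda>p. \<forall>m. \<exists>n. m < n \<and> fst p n = snd p n)"
    by (intro pred_intros_countable pred_intros_logic collide) simp
  then have ev: "{p \<in> space (traj \<Otimes>\<^sub>M traj). \<exists>\<^sub>\<infinity>n. fst p n = snd p n} \<in> sets (traj \<Otimes>\<^sub>M traj)"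
    unfolding INFM_nat by (rule predE)
  have "AE p in srw_law G v \<Otimes>\<^sub>M srw_law G v. \<exists>\<^sub>\<infinity>n. fst p n = snd p n"
    using coll v by (simp add: collision_graph_def case_prod_beta)
  then have "AE p in srw_law G v \<Otimes>\<^sub>M srw_law G v. \<exists>\<^sub>\<infinity>n. f (fst p n) = f (snd p n)"
    by (rule eventually_mono) (auto elim!: INFM_mono)
  then have "AE p in srw_law H w \<Otimes>\<^sub>M srw_law H w. \<exists>\<^sub>\<infinity>n. fst p n = snd p n"
    unfolding prod AE_distr_iff[OF m2 ev] by (simp add: case_prod_beta)
  then show "AE (x, y) in srw_law H w \<Otimes>\<^sub>M srw_law H w. \<exists>\<^sub>\<infinity>n. x n = y n"
    by (simp add: case_prod_beta)
qed


section \<open>The spaces of rooted and doubly-rooted graphs\<close>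

fun rooted_eq :: "multigraph \<times> nat \<Rightarrow> multigraph \<times> nat \<Rightarrow> bool" where
  "rooted_eq (G, u) (H, v) \<longleftrightarrow>
     conn_lf_multigraph G \<and> u \<in> verts G \<and> conn_lf_multigraph H \<and> v \<in> verts H \<and>
     marked_iso G [u] H [v]"

fun birooted_eq :: "multigraph \<times> nat \<times> nat \<Rightarrow> multigraph \<times> nat \<times> nat \<Rightarrow> bool" where
  "birooted_eq (G, u, u') (H, v, v') \<longleftrightarrow>
     conn_lf_multigraph G \<and> u \<in> verts G \<and> u' \<in> verts G \<and>
     conn_lf_multigraph H \<and> v \<in> verts H \<and> v' \<in> verts H \<and> marked_iso G [u, u'] H [v, v']"

lemma conn_lf_point: "conn_lf_multigraph \<lparr>verts = {0}, edges = {}, ends = \<lambda>_. {}\<rparr>"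
  by (simp add: conn_lf_multigraph_def wf_multigraph_def locally_finite_def edges_at_def
      connected_graph_def)

quotient_type rooted_graph = "multigraph \<times> nat" / partial: rooted_eq
proof (rule part_equivpI)
  show "\<exists>x. rooted_eq x x"
    using conn_lf_point by (intro exI[of _ "(\<lparr>verts = {0}, edges = {}, ends = \<lambda>_. {}\<rparr>, 0)"])
      (simp add: marked_iso_refl)
  show "symp rooted_eq"
    by (auto intro!: sympI marked_iso_sym simp: conn_lf_multigraph_def)
  show "transp rooted_eq"
    by (auto intro!: transpI intro: marked_iso_trans)
qed

quotient_type birooted_graph = "multigraph \<times> nat \<times> nat" / partial: birooted_eq
proof (rule part_equivpI)
  show "\<exists>x. birooted_eq x x"
    using conn_lf_point by (intro exI[of _ "(\<lparr>verts = {0}, edges = {}, ends = \<lambda>_. {}\<rparr>, 0, 0)"])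
      (simp add: marked_iso_refl)
  show "symp birooted_eq"
    by (auto intro!: sympI marked_iso_sym simp: conn_lf_multigraph_def)
  show "transp birooted_eq"
    by (auto intro!: transpI intro: marked_iso_trans)
qed

lift_definition same_rooted_balls :: "nat \<Rightarrow> rooted_graph \<Rightarrow> rooted_graph \<Rightarrow> bool" is
  "\<lambda>r (G, u) (H, v). same_balls r G [u] H [v]"
  by (clarsimp, rule same_balls_cong) (auto simp: conn_lf_multigraph_def)

lift_definition same_birooted_balls :: "nat \<Rightarrow> birooted_graph \<Rightarrow> birooted_graph \<Rightarrow> bool" is
  "\<lambda>r (G, u, u') (H, v, v'). same_balls r G [u, u'] H [v, v']"
  by (clarsimp, rule same_balls_cong) (auto simp: conn_lf_multigraph_def)

text \<open>
  In the local topology, the graphs with the same ball of radius \<open>r\<close> around the root(s) as \<open>x\<close>, for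
  \<open>r = 0, 1, \<dots>\<close>, form a neighbourhood base at \<open>x\<close>. For fixed \<open>r\<close> these sets are the
  classes of an equivalence relation that gets finer as \<open>r\<close> grows.
\<close>

instantiation rooted_graph :: topological_space
begin

definition open_rooted_graph :: "rooted_graph set \<Rightarrow> bool" where
  "open_rooted_graph = generate_topology {{y. same_rooted_balls r x y} | r x. True}"

instance
  by standard (auto simp: open_rooted_graph_def intro: generate_topology.intros generate_topology_Union)

end

instantiation birooted_graph :: topological_space
begin

definition open_birooted_graph :: "birooted_graph set \<Rightarrow> bool" where
  "open_birooted_graph = generate_topology {{y. same_birooted_balls r x y} | r x. True}"

instance
  by standard (auto simp: open_birooted_graph_def intro: generate_topology.intros generate_topology_Union)

end

lift_definition infinite_graph :: "rooted_graph \<Rightarrow> bool" is "\<lambda>(G, \<rho>). infinite (verts G)"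
  by (auto simp: marked_iso_def graph_iso_def dest: bij_betw_finite)

lift_definition recurrent :: "rooted_graph \<Rightarrow> bool" is "\<lambda>(G, \<rho>). recurrent_graph G"
  by (clarsimp simp: marked_iso_def conn_lf_multigraph_def) (metis graph_iso_sym recurrent_graph_iso)

lift_definition infinite_collision :: "rooted_graph \<Rightarrow> bool" is "\<lambda>(G, \<rho>). collision_graph G"
  by (clarsimp simp: marked_iso_def conn_lf_multigraph_def) (metis graph_iso_sym collision_graph_iso)

lemma endpoint_law_iso:
  assumes eq: "rooted_eq (G, u) (H, v)"
    and abs: "\<And>f g w. graph_iso f g G H \<Longrightarrow> f u = v \<Longrightarrow> w \<in> verts G \<Longrightarrow> a w = b (f w)"
  shows "distr (srw_law G u) (borel :: birooted_graph measure) (\<lambda>x. a (x n)) =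
         distr (srw_law H v) borel (\<lambda>x. b (x n))"
proof -
  obtain f g where f: "graph_iso f g G H" "f u = v"
    using eq by (auto simp: marked_iso_def)
  have G: "wf_multigraph G" "locally_finite G" "u \<in> verts G"
    using eq by (auto simp: conn_lf_multigraph_def)
  have m: "(\<lambda>x n. f (x n)) \<in> srw_law G u \<rightarrow>\<^sub>M traj"
    using measurable_traj_map by (simp add: measurable_cong_sets[OF sets_srw_law refl])
  have at: "(\<lambda>x. c (x n)) \<in> traj \<rightarrow>\<^sub>M (borel :: birooted_graph measure)" for c
    by (rule measurable_compose[OF measurable_component_singleton]) auto
  have "distr (srw_law H v) borel (\<lambda>x. b (x n)) = distr (srw_law G u) borel (\<lambda>x. b (f (x n)))"
    unfolding f(2)[symmetric] srw_law_iso[OF f(1) G]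
    using distr_distr[OF at[of b] m] by (simp add: o_def)
  also have "\<dots> = distr (srw_law G u) borel (\<lambda>x. a (x n))"
  proof (rule distr_cong_AE)
    show "AE x in srw_law G u. b (f (x n)) = a (x n)"
      using AE_srw_in_verts[OF G] by eventually_elim (simp add: abs[OF f])
  qed (use at in \<open>simp_all add: measurable_cong_sets[OF sets_srw_law refl]\<close>)
  finally show ?thesis by simp
qed

lemma abs_birooted_iso:
  assumes "rooted_eq (G, u) (H, v)" "graph_iso f g G H" "w \<in> verts G" "w' \<in> verts G"
  shows "abs_birooted_graph (G, w, w') = abs_birooted_graph (H, f w, f w')"
proof (rule Quotient3_rel_abs[OF Quotient3_birooted_graph])
  have "f w \<in> verts H" "f w' \<in> verts H"
    using assms by (auto simp: graph_iso_def bij_betw_def)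
  then show "birooted_eq (G, w, w') (H, f w, f w')"
    using assms by (auto simp: marked_iso_def)
qed

text \<open>
  For a fixed \<open>(G, \<rho>)\<close>, and \<open>X\<close> the simple random walk on \<open>G\<close> started at \<open>\<rho>\<close>, the laws of
  \<open>(G, \<rho>, X\<^sub>n)\<close> and of \<open>(G, X\<^sub>n, \<rho>)\<close>.
\<close>

lift_definition root_walk_law :: "nat \<Rightarrow> rooted_graph \<Rightarrow> birooted_graph measure" is
  "\<lambda>n (G, \<rho>). distr (srw_law G \<rho>) borel (\<lambda>x. abs_birooted_graph (G, \<rho>, x n))"
  by (clarsimp simp del: rooted_eq.simps)
     (rule endpoint_law_iso, assumption, auto intro!: abs_birooted_iso)

lift_definition walk_root_law :: "nat \<Rightarrow> rooted_graph \<Rightarrow> birooted_graph measure" is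
  "\<lambda>n (G, \<rho>). distr (srw_law G \<rho>) borel (\<lambda>x. abs_birooted_graph (G, x n, \<rho>))"
  by (clarsimp simp del: rooted_eq.simps)
     (rule endpoint_law_iso, assumption, auto intro!: abs_birooted_iso)

text \<open>
  \<open>\<Gamma>\<close> is a random rooted graph \<open>(G, \<rho>)\<close> on the probability space \<open>M\<close>, and \<open>X\<close> is, conditionally
  on it, a simple random walk. By the law of total probability the two sides are the probabilities
  that \<open>(G, \<rho>, X\<^sub>n) \<in> A\<close> and that \<open>(G, X\<^sub>n, \<rho>) \<in> A\<close>.
\<close>

definition reversible :: "'a measure \<Rightarrow> ('a \<Rightarrow> rooted_graph) \<Rightarrow> bool" where
  "reversible M \<Gamma> \<longleftrightarrow> (\<forall>n. \<forall>A\<in>sets borel.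
     (\<integral>\<^sup>+\<omega>. emeasure (root_walk_law n (\<Gamma> \<omega>)) A \<partial>M) =
     (\<integral>\<^sup>+\<omega>. emeasure (walk_root_law n (\<Gamma> \<omega>)) A \<partial>M))"

end

theory Submission
  imports Defs
begin

text \<open>
  Let \<open>p\<^sub>n(u, v)\<close> be the \<open>n\<close>-step transition probabilities and \<open>q(v)\<close> the probability that two
  independent walks from \<open>v\<close> never meet after time \<open>0\<close>. The last meeting of two walks from \<open>\<rho>\<close> happens
  at time \<open>n\<close> in \<open>v\<close> with probability \<open>p\<^sub>n(\<rho>, v)\<^sup>2 q(v)\<close>, and these events are disjoint. Reversibility,
  applied to \<open>(G, u, v) \<mapsto> p\<^sub>n(u, v) q(v)\<close>, turns the expected sum of these probabilities into the
  expectation of \<open>q(\<rho>) \<Sum>\<^sub>n p\<^sub>2\<^sub>n(\<rho>, \<rho>)\<close>, which is therefore at most \<open>1\<close>. By recurrence the sum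
  diverges, so \<open>q(\<rho>) = 0\<close> almost surely; by stationarity \<open>q\<close> vanishes at all vertices, so that
  no meeting is the last one.

  Measurability comes for free by truncating \<open>q\<close> at a finite time: all functionals involved then only
  depend on a ball around the roots, so they are locally constant in the local topology.
\<close>

section \<open>The Markov property\<close>

text \<open>The transition probabilities \<open>p\<^sub>n(v, _)\<close>. A prefix of length
  \<open>Suc n\<close> holds the positions at times 0 to \<open>n\<close>, so its last entry is the
  position at time \<open>n\<close>.\<close>

definition srw_pos :: "multigraph \<Rightarrow> nat \<Rightarrow> nat \<Rightarrow> nat pmf" where
  "srw_pos G v n = map_pmf last (srw_prefix G v (Suc n))"

lemma length_srw_prefix: "xs \<in> set_pmf (srw_prefix G v n) \<Longrightarrow> length xs = n"
  by (induction n arbitrary: xs) auto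

lemma srw_pos_0: "srw_pos G v 0 = return_pmf v"
  by (simp add: srw_pos_def bind_return_pmf)

lemma srw_prefix_Suc:
  "srw_prefix G v (Suc (Suc n)) =
     bind_pmf (srw_prefix G v (Suc n)) (\<lambda>xs. map_pmf (\<lambda>y. xs @ [y]) (srw_step G (last xs)))"
  by (subst srw_prefix.simps(2)) simp

lemma srw_pos_Suc: "srw_pos G v (Suc n) = bind_pmf (srw_pos G v n) (srw_step G)"
  unfolding srw_pos_def srw_prefix_Suc
  by (simp add: map_bind_pmf pmf.map_comp o_def bind_map_pmf del: srw_prefix.simps)

text \<open>Chapman-Kolmogorov, by induction on the second time because \<open>srw_pos_Suc\<close>
  appends a step at the end.\<close>

lemma srw_pos_add: "srw_pos G v (m + n) = bind_pmf (srw_pos G v m) (\<lambda>u. srw_pos G u n)"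
proof (induction n)
  case 0
  then show ?case by (simp add: srw_pos_0 bind_return_pmf')
next
  case (Suc n)
  then show ?case by (simp add: srw_pos_Suc bind_assoc_pmf)
qed

text \<open>The Markov property at time \<open>n\<close> on the level of finite prefixes: what
  remains after the first \<open>n\<close> positions is a prefix of a walk restarted at the position
  reached.\<close>

lemma srw_prefix_drop:
  "map_pmf (drop n) (srw_prefix G v (n + m)) = bind_pmf (srw_pos G v n) (\<lambda>u. srw_prefix G u m)"
proof (induction m)
  case 0
  have "map_pmf (drop n) (srw_prefix G v n) = map_pmf (\<lambda>_. []) (srw_prefix G v n)"
    by (intro map_pmf_cong refl) (simp add: length_srw_prefix)
  then show ?case by simp
next
  case (Suc m)
  show ?case
  \<comment> \<open>The first entry of the restarted prefix is its starting vertex and not the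
    result of a step, so the passage from length 0 to length 1 is separate.\<close>
  proof (cases m)
    case 0
    have "map_pmf (drop n) (srw_prefix G v (Suc n)) = map_pmf (\<lambda>xs. [last xs]) (srw_prefix G v (Suc n))"
    proof (intro map_pmf_cong refl)
      fix xs assume "xs \<in> set_pmf (srw_prefix G v (Suc n))"
      then have l: "length xs = Suc n" by (rule length_srw_prefix)
      then have "xs \<noteq> []" by auto
      then have "xs = butlast xs @ [last xs]" by simp
      moreover have "length (butlast xs) = n" using l by simp
      ultimately show "drop n xs = [last xs]" by (metis append_eq_conv_conj)
    qed
    also have "\<dots> = bind_pmf (srw_pos G v n) (\<lambda>u. return_pmf [u])"
      by (simp add: srw_pos_def map_pmf_def bind_assoc_pmf bind_return_pmf del: srw_prefix.simps)
    finally show ?thesis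
      using 0 by (simp add: bind_return_pmf del: srw_prefix.simps(2)) (simp add: bind_return_pmf)
  next
    case (Suc k)
    have "map_pmf (drop n) (srw_prefix G v (n + Suc m)) =
       bind_pmf (srw_prefix G v (n + m)) (\<lambda>xs. map_pmf (\<lambda>y. drop n (xs @ [y])) (srw_step G (last xs)))"
      using Suc by (simp add: srw_prefix_Suc map_bind_pmf pmf.map_comp o_def del: srw_prefix.simps drop_append)
    \<comment> \<open>Since \<open>m\<close> is positive, dropping \<open>n\<close> entries leaves a
      nonempty list with the same last entry, and the next step depends on that entry only.\<close>
    also have "\<dots> = bind_pmf (srw_prefix G v (n + m))
        (\<lambda>xs. map_pmf (\<lambda>y. drop n xs @ [y]) (srw_step G (last (drop n xs))))"
    proof (intro bind_pmf_cong refl)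
      fix xs assume "xs \<in> set_pmf (srw_prefix G v (n + m))"
      then have "length xs = n + m" by (rule length_srw_prefix)
      then show "map_pmf (\<lambda>y. drop n (xs @ [y])) (srw_step G (last xs)) =
          map_pmf (\<lambda>y. drop n xs @ [y]) (srw_step G (last (drop n xs)))"
        using Suc by (simp add: last_drop)
    qed
    also have "\<dots> = bind_pmf (map_pmf (drop n) (srw_prefix G v (n + m)))
        (\<lambda>xs. map_pmf (\<lambda>y. xs @ [y]) (srw_step G (last xs)))"
      by (simp add: bind_map_pmf)
    also have "\<dots> = bind_pmf (srw_pos G v n) (\<lambda>u. srw_prefix G u (Suc m))"
      unfolding Suc.IH bind_assoc_pmf using Suc by (simp add: srw_prefix_Suc del: srw_prefix.simps)
    finally show ?thesis .
  qed
qed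

section \<open>The Markov property for infinite trajectories\<close>

lemma measurable_srw_law: "srw_law G \<in> count_space UNIV \<rightarrow>\<^sub>M subprob_algebra traj"
proof -
  have "srw_law G v \<in> space (subprob_algebra traj)" for v
    using prob_space_srw_law by (simp add: space_subprob_algebra prob_space_imp_subprob_space)
  then show ?thesis by (simp add: Pi_iff)
qed

lemma measurable_shift: "(\<lambda>x k. x (n + k)) \<in> traj \<rightarrow>\<^sub>M traj"
  by (rule measurable_PiM_single') (auto intro: measurable_component_singleton)

text \<open>Laws of trajectories are determined by the laws of their prefixes
  (\<open>traj_measure_eqI\<close>), so \<open>srw_prefix_drop\<close> lifts to the whole future of
  the walk.\<close>

lemma srw_law_shift:
  "distr (srw_law G v) traj (\<lambda>x k. x (n + k)) = measure_pmf (srw_pos G v n) \<bind> srw_law G"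
proof (rule traj_measure_eqI)
  let ?D = "distr (srw_law G v) traj (\<lambda>x k. x (n + k))"
  have sh: "(\<lambda>x k. x (n + k)) \<in> srw_law G v \<rightarrow>\<^sub>M traj"
    using measurable_shift by (simp add: measurable_cong_sets[OF sets_srw_law refl])
  have pre: "(\<lambda>x. map x [0..<m]) \<in> traj \<rightarrow>\<^sub>M count_space UNIV" for m
    by (rule measurable_prefix) simp
  have pre': "(\<lambda>x. map x [0..<m]) \<in> srw_law G v \<rightarrow>\<^sub>M count_space UNIV" for m
    using pre by (simp add: measurable_cong_sets[OF sets_srw_law refl])
  have m: "srw_law G \<in> measure_pmf p \<rightarrow>\<^sub>M subprob_algebra traj" for p
    using measurable_srw_law by (simp add: measurable_cong_sets[OF sets_measure_pmf_count_space refl])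
  show "sets (measure_pmf (srw_pos G v n) \<bind> srw_law G) = sets traj"
    by (subst sets_bind[of _ _ traj]) auto
  interpret prob_space "srw_law G v" by (rule prob_space_srw_law)
  interpret D: prob_space ?D using sh by (rule prob_space_distr)
  show "finite_measure ?D" by unfold_locales
  fix k
  have "distr ?D (count_space UNIV) (\<lambda>x. map x [0..<k]) =
      distr (srw_law G v) (count_space UNIV) (drop n \<circ> (\<lambda>x. map x [0..<n + k]))"
    by (subst distr_distr[OF pre sh], intro distr_cong refl, rule nth_equalityI) auto
  also have "\<dots> = distr (distr (srw_law G v) (count_space UNIV) (\<lambda>x. map x [0..<n + k])) (count_space UNIV) (drop n)"
    by (rule distr_distr[symmetric]) (auto intro: pre')
  also have "\<dots> = measure_pmf (map_pmf (drop n) (srw_prefix G v (n + k)))"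
    by (simp add: distr_srw_prefix map_pmf_rep_eq)
  also have "\<dots> = measure_pmf (srw_pos G v n) \<bind> (\<lambda>u. measure_pmf (srw_prefix G u k))"
    by (simp add: srw_prefix_drop measure_pmf_bind)
  also have "\<dots> = distr (measure_pmf (srw_pos G v n) \<bind> srw_law G) (count_space UNIV) (\<lambda>x. map x [0..<k])"
    by (subst distr_bind[OF m _ pre]) (simp_all add: distr_srw_prefix)
  finally show "distr ?D (count_space UNIV) (\<lambda>x. map x [0..<k]) = \<dots>" .
qed simp

lemma nn_integral_srw_shift:
  assumes "F \<in> borel_measurable traj"
  shows "(\<integral>\<^sup>+x. F (\<lambda>k. x (n + k)) \<partial>srw_law G v) = (\<integral>\<^sup>+u. (\<integral>\<^sup>+x. F x \<partial>srw_law G u) \<partial>srw_pos G v n)"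
proof -
  have sh: "(\<lambda>x k. x (n + k)) \<in> srw_law G v \<rightarrow>\<^sub>M traj"
    using measurable_shift by (simp add: measurable_cong_sets[OF sets_srw_law refl])
  have m: "srw_law G \<in> measure_pmf p \<rightarrow>\<^sub>M subprob_algebra traj" for p
    using measurable_srw_law by (simp add: measurable_cong_sets[OF sets_measure_pmf_count_space refl])
  have "(\<integral>\<^sup>+x. F (\<lambda>k. x (n + k)) \<partial>srw_law G v) = (\<integral>\<^sup>+x. F x \<partial>distr (srw_law G v) traj (\<lambda>x k. x (n + k)))"
    by (rule nn_integral_distr[symmetric, OF sh]) (simp add: assms)
  also have "\<dots> = (\<integral>\<^sup>+u. (\<integral>\<^sup>+x. F x \<partial>srw_law G u) \<partial>srw_pos G v n)"
    unfolding srw_law_shift by (rule nn_integral_bind[OF assms m])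
  finally show ?thesis .
qed

lemma distr_srw_pos: "distr (srw_law G v) (count_space UNIV) (\<lambda>x. x n) = measure_pmf (srw_pos G v n)"
proof -
  have p: "(\<lambda>x. map x [0..<Suc n]) \<in> srw_law G v \<rightarrow>\<^sub>M count_space UNIV"
    using measurable_prefix[of "Suc n" UNIV] by (simp add: measurable_cong_sets[OF sets_srw_law refl] del: upt_Suc)
  have "distr (srw_law G v) (count_space UNIV) (\<lambda>x. x n) =
      distr (srw_law G v) (count_space UNIV) (last \<circ> (\<lambda>x. map x [0..<Suc n]))"
    by (intro distr_cong) auto
  also have "\<dots> = distr (distr (srw_law G v) (count_space UNIV) (\<lambda>x. map x [0..<Suc n])) (count_space UNIV) last"
    by (rule distr_distr[symmetric]) (auto intro: p simp del: upt_Suc)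
  also have "\<dots> = measure_pmf (srw_pos G v n)"
    unfolding distr_srw_prefix srw_pos_def by (simp add: map_pmf_rep_eq del: srw_prefix.simps)
  finally show ?thesis .
qed

lemma measurable_pos_srw: "(\<lambda>x. x n) \<in> srw_law G v \<rightarrow>\<^sub>M count_space UNIV"
  by (simp add: measurable_cong_sets[OF sets_srw_law refl])

lemma AE_srw_start: "AE x in srw_law G v. x 0 = v"
proof -
  have "AE y in measure_pmf (srw_pos G v 0). y = v"
    by (simp add: srw_pos_0 AE_measure_pmf_iff)
  then show ?thesis
    unfolding distr_srw_pos[symmetric] by (subst (asm) AE_distr_iff[OF measurable_pos_srw]) auto
qed

lemma AE_srw_shift:
  assumes P: "Measurable.pred traj P"
  shows "(AE x in srw_law G v. P (\<lambda>k. x (n + k))) \<longleftrightarrow>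
    (\<forall>u\<in>set_pmf (srw_pos G v n). AE x in srw_law G u. P x)"
proof -
  have sh: "(\<lambda>x k. x (n + k)) \<in> srw_law G v \<rightarrow>\<^sub>M traj"
    using measurable_shift by (simp add: measurable_cong_sets[OF sets_srw_law refl])
  have m: "srw_law G \<in> measure_pmf p \<rightarrow>\<^sub>M subprob_algebra traj" for p
    using measurable_srw_law by (simp add: measurable_cong_sets[OF sets_measure_pmf_count_space refl])
  have "(AE x in srw_law G v. P (\<lambda>k. x (n + k))) \<longleftrightarrow>
      (AE x in distr (srw_law G v) traj (\<lambda>x k. x (n + k)). P x)"
    using predE[OF P] by (intro AE_distr_iff[OF sh, symmetric]) simp
  also have "\<dots> \<longleftrightarrow> (\<forall>u\<in>set_pmf (srw_pos G v n). AE x in srw_law G u. P x)"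
    unfolding srw_law_shift AE_bind[OF m P] AE_measure_pmf_iff ..
  finally show ?thesis .
qed

lemma set_srw_pos:
  assumes "wf_multigraph G" "locally_finite G" "v \<in> verts G"
  shows "set_pmf (srw_pos G v n) \<subseteq> verts G"
proof
  fix w assume "w \<in> set_pmf (srw_pos G v n)"
  then obtain xs where "xs \<in> set_pmf (srw_prefix G v (Suc n))" "w = last xs"
    by (auto simp: srw_pos_def simp del: srw_prefix.simps)
  moreover from this(1) have "length xs = Suc n" "set xs \<subseteq> verts G"
    using set_srw_prefix[OF assms] by blast+
  ultimately show "w \<in> verts G"
    by (metis last_in_set length_0_conv nat.distinct(1) subsetD)
qed

section \<open>Return probabilities of recurrent graphs\<close>

text \<open>If the sum converged, Borel-Cantelli would allow only finitely many visits to
  \<open>v\<close>; but by recurrence and the Markov property every visit is followed by another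
  one.\<close>

lemma recurrent_not_summable:
  assumes "recurrent_graph G" "v \<in> verts G"
  shows "\<not> summable (\<lambda>n. pmf (srw_pos G v n) v)"
proof
  assume sum: "summable (\<lambda>n. pmf (srw_pos G v n) v)"
  interpret prob_space "srw_law G v" by (rule prob_space_srw_law)
  have pos: "(\<lambda>x. x n) \<in> traj \<rightarrow>\<^sub>M count_space UNIV" for n
    by simp
  \<comment> \<open>The implication form makes this property almost sure from every starting vertex,
    trivially so from vertices other than \<open>v\<close>. The Markov property at fixed times
    therefore yields a next visit after each visit.\<close>
  have P: "Measurable.pred traj (\<lambda>x. x 0 = v \<longrightarrow> (\<exists>k\<ge>1. x k = v))"
    by (intro pred_intros_logic pred_intros_countable pred_count_space_const1 pos) simp_all
  have "AE x in srw_law G u. x 0 = v \<longrightarrow> (\<exists>k\<ge>1. x k = v)" for u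
  proof (cases "u = v")
    case True
    have "AE x in srw_law G v. \<exists>k\<ge>1. x k = v"
      using assms unfolding recurrent_graph_def by blast
    then show ?thesis
      unfolding True by (rule eventually_mono) simp
  next
    case False
    then show ?thesis
      using AE_srw_start[where G=G and v=u] by eventually_elim (use False in simp)
  qed
  then have "AE x in srw_law G v. x (n + 0) = v \<longrightarrow> (\<exists>k\<ge>1. x (n + k) = v)" for n
    using AE_srw_shift[OF P, where G=G and v=v and n=n] by blast
  then have "AE x in srw_law G v. \<forall>n. x (n + 0) = v \<longrightarrow> (\<exists>k\<ge>1. x (n + k) = v)"
    by (subst AE_all_countable) blast
  moreover have "AE x in srw_law G v. eventually (\<lambda>n. x \<in> space (srw_law G v) - {x. x n = v}) sequentially"
  proof (rule borel_cantelli_AE1)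
    fix n
    show "{x. x n = v} \<in> sets (srw_law G v)"
      using measurable_sets[OF measurable_pos_srw, of "{v}" n G v] by (simp add: vimage_def)
  next
    have "measure (srw_law G v) {x. x n = v} = pmf (srw_pos G v n) v" for n
    proof -
      have "emeasure (srw_law G v) {x. x n = v} =
          emeasure (distr (srw_law G v) (count_space UNIV) (\<lambda>x. x n)) {v}"
        by (subst emeasure_distr[OF measurable_pos_srw]) (auto simp: vimage_def)
      then show ?thesis
        by (simp add: distr_srw_pos emeasure_pmf_single measure_def)
    qed
    then show "summable (\<lambda>n. measure (srw_law G v) {x. x n = v})"
      using sum by simp
  qed (simp add: top.not_eq_extremum[symmetric])
  ultimately have "AE x in srw_law G v. False"
    using AE_srw_start
  proof eventually_elim
    case (elim x)
    have inf: "\<exists>n\<ge>N. x n = v" for N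
    proof (induction N)
      case 0
      then show ?case using elim(3) by auto
    next
      case (Suc N)
      then obtain n where "n \<ge> N" "x n = v" by auto
      moreover from this obtain k where "k \<ge> 1" "x (n + k) = v"
        using elim(1) by auto
      ultimately show ?case by (intro exI[of _ "n + k"]) auto
    qed
    then show ?case
      using elim(2) by (auto simp: eventually_sequentially)
  qed
  then show False by simp
qed

text \<open>Only the contribution of \<open>u = v\<close> is kept in the Chapman-Kolmogorov
  sum.\<close>

lemma pmf_srw_pos_add: "pmf (srw_pos G v m) v * pmf (srw_pos G v n) v \<le> pmf (srw_pos G v (m + n)) v"
proof -
  have "ennreal (pmf (srw_pos G v m) v) * ennreal (pmf (srw_pos G v n) v) =
      (\<integral>\<^sup>+u. ennreal (pmf (srw_pos G u n) v) * indicator {v} u \<partial>srw_pos G v m)"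
    by (subst nn_integral_indicator_singleton) (simp_all add: emeasure_pmf_single mult.commute)
  also have "\<dots> \<le> (\<integral>\<^sup>+u. ennreal (pmf (srw_pos G u n) v) \<partial>srw_pos G v m)"
    by (intro nn_integral_mono) (simp split: split_indicator)
  also have "\<dots> = ennreal (pmf (srw_pos G v (m + n)) v)"
    by (simp add: srw_pos_add ennreal_pmf_bind)
  finally show ?thesis
    by (simp add: ennreal_mult[symmetric])
qed

text \<open>The main estimate controls return probabilities at even times only. Periodic walks are
  no obstacle: summability at even times would spread to odd times.\<close>

lemma not_summable_even_times:
  fixes u :: "nat \<Rightarrow> real"
  assumes nonneg: "\<And>n. 0 \<le> u n" and super: "\<And>m n. u m * u n \<le> u (m + n)" and inf: "\<not> summable u"
  shows "\<not> summable (\<lambda>n. u (2 * n))"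
proof
  assume even: "summable (\<lambda>n. u (2 * n))"
  have odd: "summable (\<lambda>n. u (2 * n + 1))"
  proof (cases "\<exists>j. u (2 * j + 1) \<noteq> 0")
    case True
    then obtain j where "u (2 * j + 1) \<noteq> 0" by blast
    \<comment> \<open>Appending a return of odd length \<open>2 * j + 1\<close> turns odd return times into even ones.\<close>
    then have j: "u (2 * j + 1) > 0"
      using nonneg[of "2 * j + 1"] by linarith
    have le: "u (2 * n + 1) \<le> u (2 * (n + Suc j)) / u (2 * j + 1)" for n
      using j super[of "2 * n + 1" "2 * j + 1"] by (simp add: pos_le_divide_eq algebra_simps)
    have "summable (\<lambda>n. u (2 * (n + Suc j)) / u (2 * j + 1))"
      using summable_ignore_initial_segment[OF even, of "Suc j"] by (rule summable_divide)
    then show ?thesis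
      by (rule summable_comparison_test') (use nonneg le in simp)
  next
    case False
    then show ?thesis by simp
  qed
  \<comment> \<open>The interleaving of the two subsequences, in the shape in which
    \<open>sums_if\<close> sums it, is \<open>u\<close> itself.\<close>
  have "(\<lambda>n. if even n then u (2 * (n div 2)) else u (2 * ((n - 1) div 2) + 1)) = u"
  proof
    fix n show "(if even n then u (2 * (n div 2)) else u (2 * ((n - 1) div 2) + 1)) = u n"
      by (cases "even n") (simp_all add: odd_two_times_div_two_nat)
  qed
  then show False
    using sums_if[OF summable_sums[OF odd] summable_sums[OF even]] inf by (simp add: summable_def)
qed

lemma recurrent_suminf_even:
  assumes "recurrent_graph G" "v \<in> verts G"
  shows "(\<Sum>n. ennreal (pmf (srw_pos G v (2 * n)) v)) = \<infinity>"
proof (rule ccontr)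
  assume "(\<Sum>n. ennreal (pmf (srw_pos G v (2 * n)) v)) \<noteq> \<infinity>"
  then have "summable (\<lambda>n. pmf (srw_pos G v (2 * n)) v)"
    by (intro summable_suminf_not_top) auto
  moreover have "\<not> summable (\<lambda>n. pmf (srw_pos G v (2 * n)) v)"
    using recurrent_not_summable[OF assms]
    by (intro not_summable_even_times) (auto intro: pmf_srw_pos_add)
  ultimately show False by contradiction
qed

section \<open>Meetings of two walks\<close>

lemma measurable_meet: "Measurable.pred (traj \<Otimes>\<^sub>M traj) (\<lambda>p. fst p n = snd p n)"
proof -
  have x: "(\<lambda>x. x n) \<in> traj \<rightarrow>\<^sub>M count_space UNIV"
    by simp
  \<comment> \<open>Naming the common vertex \<open>k\<close> turns the meeting into a countable
    union of conditions on one walk each.\<close>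
  have "(\<lambda>p. \<exists>k. snd p n = k \<and> fst p n = k) \<in> traj \<Otimes>\<^sub>M traj \<rightarrow>\<^sub>M count_space UNIV"
    by (intro pred_intros_countable pred_intros_logic pred_count_space_const1
          measurable_compose[OF measurable_fst x] measurable_compose[OF measurable_snd x])
  then show ?thesis by simp
qed

lemma space_traj_pair: "space (traj \<Otimes>\<^sub>M traj) = UNIV"
  by (simp add: space_pair_measure space_PiM)

lemma sets_srw_law_pair: "sets (srw_law G u \<Otimes>\<^sub>M srw_law H v) = sets (traj \<Otimes>\<^sub>M traj)"
  by (intro sets_pair_measure_cong sets_srw_law)

text \<open>The meeting at time \<open>n\<close> is the last one only up to time
  \<open>n + N\<close>; the true last meeting is the intersection over all \<open>N\<close>, used in
  \<open>collision_graphI\<close>.\<close>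

definition last_meeting :: "nat \<Rightarrow> nat \<Rightarrow> ((nat \<Rightarrow> nat) \<times> (nat \<Rightarrow> nat)) set" where
  "last_meeting n N = {p. fst p n = snd p n \<and> (\<forall>k\<in>{1..N}. fst p (n + k) \<noteq> snd p (n + k))}"

text \<open>The truncation of \<open>q(u)\<close> at time \<open>N\<close>, decreasing to
  \<open>q(u)\<close> as \<open>N\<close> grows. Time 0 is left out because both walks start at
  \<open>u\<close>.\<close>

definition meet_free :: "multigraph \<Rightarrow> nat \<Rightarrow> nat \<Rightarrow> ennreal" where
  "meet_free G N u = emeasure (srw_law G u \<Otimes>\<^sub>M srw_law G u) {p. \<forall>k\<in>{1..N}. fst p k \<noteq> snd p k}"

lemma sets_last_meeting: "last_meeting n N \<in> sets (traj \<Otimes>\<^sub>M traj)"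
proof -
  have "Measurable.pred (traj \<Otimes>\<^sub>M traj) (\<lambda>p. fst p n = snd p n \<and> (\<forall>k\<in>{1..N}. fst p (n + k) \<noteq> snd p (n + k)))"
    by (intro pred_intros_logic pred_intros_finite measurable_meet) auto
  from predE[OF this] show ?thesis
    by (simp add: last_meeting_def space_traj_pair)
qed

lemma sets_meet_free: "{p. \<forall>k\<in>{1..N}. fst p k \<noteq> snd p k} \<in> sets (traj \<Otimes>\<^sub>M traj)"
proof -
  have "Measurable.pred (traj \<Otimes>\<^sub>M traj) (\<lambda>p. \<forall>k\<in>{1..N}. fst p k \<noteq> snd p k)"
    by (intro pred_intros_logic pred_intros_finite measurable_meet) auto
  from predE[OF this] show ?thesis
    by (simp add: space_traj_pair)
qed

lemma emeasure_srw_law_pair: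
  assumes "A \<in> sets (traj \<Otimes>\<^sub>M traj)"
  shows "emeasure (srw_law G u \<Otimes>\<^sub>M srw_law H v) A = (\<integral>\<^sup>+x. \<integral>\<^sup>+y. indicator A (x, y) \<partial>srw_law H v \<partial>srw_law G u)"
proof -
  interpret prob_space "srw_law H v" by (rule prob_space_srw_law)
  show ?thesis
    using assms by (intro emeasure_pair_measure) (simp add: sets_srw_law_pair)
qed

text \<open>The Markov property at time \<open>n\<close> is applied to both walks: they must be at a
  common vertex \<open>w\<close>, and the walks restarted there must avoid each other. The factor
  \<open>p\<^sub>n(u, w)\<close> is hidden in the measure of integration.\<close>

lemma emeasure_last_meeting:
  "emeasure (srw_law G u \<Otimes>\<^sub>M srw_law G v) (last_meeting n N) =
     (\<integral>\<^sup>+w. ennreal (pmf (srw_pos G v n) w) * meet_free G N w \<partial>srw_pos G u n)"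
proof -
  \<comment> \<open>\<open>I\<close> is the event shifted to time 0, \<open>C\<close> the same
    without the condition at time 0, and \<open>J\<close> averages \<open>I\<close> over the second
    walk, restarted from its position at time \<open>n\<close>.\<close>
  define I :: "(nat \<Rightarrow> nat) \<Rightarrow> (nat \<Rightarrow> nat) \<Rightarrow> ennreal" where "I x y = indicator (last_meeting 0 N) (x, y)" for x y
  define C :: "(nat \<Rightarrow> nat) \<Rightarrow> (nat \<Rightarrow> nat) \<Rightarrow> ennreal" where "C x y = indicator {p. \<forall>k\<in>{1..N}. fst p k \<noteq> snd p k} (x, y)" for x y
  define J where "J x = (\<integral>\<^sup>+b. \<integral>\<^sup>+y. I x y \<partial>srw_law G b \<partial>srw_pos G v n)" for x
  have I2: "(\<lambda>(x, y). I x y) \<in> borel_measurable (traj \<Otimes>\<^sub>M traj)"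
    using sets_last_meeting by (simp add: I_def)
  have I1: "I x \<in> borel_measurable traj" for x
    using measurable_Pair2[OF I2, of x] by (simp add: space_PiM)
  have Ib: "(\<lambda>x. \<integral>\<^sup>+y. I x y \<partial>srw_law G b) \<in> borel_measurable traj" for b
  proof -
    interpret prob_space "srw_law G b" by (rule prob_space_srw_law)
    have "(\<lambda>(x, y). I x y) \<in> borel_measurable (traj \<Otimes>\<^sub>M srw_law G b)"
      using I2 by (simp add: measurable_cong_sets[OF sets_pair_measure_cong[OF refl sets_srw_law] refl])
    then show ?thesis by (rule borel_measurable_nn_integral)
  qed
  have J: "J \<in> borel_measurable traj"
    \<comment> \<open>Over the countable vertex set the integral is a series, measurable term by
      term.\<close>
    unfolding J_def nn_integral_measure_pmf nn_integral_count_space_nat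
    using Ib by measurable
  have "emeasure (srw_law G u \<Otimes>\<^sub>M srw_law G v) (last_meeting n N) =
      (\<integral>\<^sup>+x. \<integral>\<^sup>+y. I (\<lambda>k. x (n + k)) (\<lambda>k. y (n + k)) \<partial>srw_law G v \<partial>srw_law G u)"
    unfolding emeasure_srw_law_pair[OF sets_last_meeting]
    by (intro nn_integral_cong) (simp add: I_def last_meeting_def indicator_def)
  also have "\<dots> = (\<integral>\<^sup>+x. J (\<lambda>k. x (n + k)) \<partial>srw_law G u)"
    unfolding J_def by (intro nn_integral_cong nn_integral_srw_shift I1)
  also have "\<dots> = (\<integral>\<^sup>+a. \<integral>\<^sup>+x. J x \<partial>srw_law G a \<partial>srw_pos G u n)"
    by (rule nn_integral_srw_shift[OF J])
  also have "\<dots> = (\<integral>\<^sup>+a. ennreal (pmf (srw_pos G v n) a) * meet_free G N a \<partial>srw_pos G u n)"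
  proof (intro nn_integral_cong)
    fix a
    \<comment> \<open>The second walk almost surely starts at \<open>b\<close>. If
      \<open>b = a\<close>, the meeting at time 0 is automatic and \<open>C\<close> remains;
      otherwise it is impossible.\<close>
    have eq: "(\<integral>\<^sup>+y. I x y \<partial>srw_law G b) = (\<integral>\<^sup>+y. C x y \<partial>srw_law G a) * indicator {a} b" if "x 0 = a" for x b
    proof (cases "b = a")
      case True
      have "(\<integral>\<^sup>+y. I x y \<partial>srw_law G a) = (\<integral>\<^sup>+y. C x y \<partial>srw_law G a)"
        by (rule nn_integral_cong_AE, use AE_srw_start[where G=G and v=a] in eventually_elim)
           (use that in \<open>auto simp: I_def C_def last_meeting_def indicator_def\<close>)
      with True show ?thesis by simp
    next
      case False
      have "(\<integral>\<^sup>+y. I x y \<partial>srw_law G b) = (\<integral>\<^sup>+y. 0 \<partial>srw_law G b)"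
        by (rule nn_integral_cong_AE, use AE_srw_start[where G=G and v=b] in eventually_elim)
           (use that False in \<open>auto simp: I_def last_meeting_def indicator_def\<close>)
      with False show ?thesis by simp
    qed
    have J_eq: "J x = ennreal (pmf (srw_pos G v n) a) * (\<integral>\<^sup>+y. C x y \<partial>srw_law G a)" if "x 0 = a" for x
    proof -
      have "J x = (\<integral>\<^sup>+b. (\<integral>\<^sup>+y. C x y \<partial>srw_law G a) * indicator {a} b \<partial>srw_pos G v n)"
        unfolding J_def by (intro nn_integral_cong eq that)
      then show ?thesis
        by (subst (asm) nn_integral_cmult_indicator) (simp_all add: emeasure_pmf_single mult.commute)
    qed
    have Cm: "(\<lambda>x. \<integral>\<^sup>+y. C x y \<partial>srw_law G a) \<in> borel_measurable (srw_law G a)"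
    proof -
      interpret prob_space "srw_law G a" by (rule prob_space_srw_law)
      have "(\<lambda>(x, y). C x y) \<in> borel_measurable (srw_law G a \<Otimes>\<^sub>M srw_law G a)"
        using sets_meet_free[of N]
        by (simp add: C_def measurable_cong_sets[OF sets_srw_law_pair refl])
      then show ?thesis by (rule borel_measurable_nn_integral)
    qed
    have "(\<integral>\<^sup>+x. J x \<partial>srw_law G a) =
        (\<integral>\<^sup>+x. ennreal (pmf (srw_pos G v n) a) * (\<integral>\<^sup>+y. C x y \<partial>srw_law G a) \<partial>srw_law G a)"
      by (rule nn_integral_cong_AE, use AE_srw_start[where G=G and v=a] in eventually_elim) (rule J_eq)
    also have "\<dots> = ennreal (pmf (srw_pos G v n) a) * (\<integral>\<^sup>+x. \<integral>\<^sup>+y. C x y \<partial>srw_law G a \<partial>srw_law G a)"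
      by (rule nn_integral_cmult[OF Cm])
    also have "\<dots> = ennreal (pmf (srw_pos G v n) a) * meet_free G N a"
      by (simp only: meet_free_def emeasure_srw_law_pair[OF sets_meet_free] C_def)
    finally show "(\<integral>\<^sup>+x. J x \<partial>srw_law G a) = ennreal (pmf (srw_pos G v n) a) * meet_free G N a" .
  qed
  finally show ?thesis .
qed

lemma prob_space_srw_law_pair: "prob_space (srw_law G u \<Otimes>\<^sub>M srw_law H v)"
  by (intro prob_space_pair prob_space_srw_law)

text \<open>All windows end at the same time \<open>N\<close>, so the events are disjoint: at most
  one meeting is the last one up to time \<open>N\<close>.\<close>

lemma sum_last_meeting_le_1:
  "(\<Sum>n\<le>N. \<integral>\<^sup>+w. ennreal (pmf (srw_pos G v n) w) * meet_free G (N - n) w \<partial>srw_pos G v n) \<le> 1"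
proof -
  interpret prob_space "srw_law G v \<Otimes>\<^sub>M srw_law G v" by (rule prob_space_srw_law_pair)
  have "disjoint_family_on (\<lambda>n. last_meeting n (N - n)) {..N}"
  unfolding disjoint_family_on_def
  proof (intro ballI impI)
    have *: "last_meeting m (N - m) \<inter> last_meeting n (N - n) = {}" if "m < n" "n \<le> N" for m n
    proof -
      \<comment> \<open>The later meeting time \<open>n\<close> lies in the window after
        \<open>m\<close> in which meetings are excluded.\<close>
      have "n - m \<in> {1..N - m}" "m + (n - m) = n" using that by auto
      then show ?thesis
        unfolding last_meeting_def by (auto dest!: bspec[of _ _ "n - m"])
    qed
    show "last_meeting m (N - m) \<inter> last_meeting n (N - n) = {}" if "m \<in> {..N}" "n \<in> {..N}" "m \<noteq> n" for m n
      using that *[of m n] *[of n m] by (cases "m < n") auto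
  qed
  then have "(\<Sum>n\<le>N. emeasure (srw_law G v \<Otimes>\<^sub>M srw_law G v) (last_meeting n (N - n))) =
      emeasure (srw_law G v \<Otimes>\<^sub>M srw_law G v) (\<Union>n\<le>N. last_meeting n (N - n))"
    by (intro sum_emeasure) (auto simp: sets_srw_law_pair sets_last_meeting)
  then show ?thesis
    by (simp add: emeasure_last_meeting emeasure_le_1)
qed

lemma meet_free_le_1: "meet_free G N v \<le> 1"
proof -
  interpret prob_space "srw_law G v \<Otimes>\<^sub>M srw_law G v" by (rule prob_space_srw_law_pair)
  show ?thesis unfolding meet_free_def by (rule emeasure_le_1)
qed

lemma meet_free_antimono: "M \<le> N \<Longrightarrow> meet_free G N v \<le> meet_free G M v"
  unfolding meet_free_def
proof (rule emeasure_mono)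
  show "{p. \<forall>k\<in>{1..M}. fst p k \<noteq> snd p k} \<in> sets (srw_law G v \<Otimes>\<^sub>M srw_law G v)"
    unfolding sets_srw_law_pair by (rule sets_meet_free)
qed auto

text \<open>If \<open>q\<close> vanishes everywhere, almost surely no meeting is the last one; since
  the walks meet at time 0, they meet infinitely often.\<close>

lemma collision_graphI:
  assumes G: "wf_multigraph G" "locally_finite G"
    and zero: "\<And>w. w \<in> verts G \<Longrightarrow> (INF N. meet_free G N w) = 0"
  shows "collision_graph G"
  unfolding collision_graph_def
proof
  fix v assume v: "v \<in> verts G"
  let ?P = "srw_law G v \<Otimes>\<^sub>M srw_law G v"
  have "AE p in ?P. \<not> (fst p n = snd p n \<and> (\<forall>k\<ge>1. fst p (n + k) \<noteq> snd p (n + k)))" for n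
  proof -
    let ?f = "\<lambda>N w. ennreal (pmf (srw_pos G v n) w) * meet_free G N w"
    define A where "A = (\<Inter>N. last_meeting n N)"
    have A: "A \<in> sets ?P"
      unfolding A_def sets_srw_law_pair by (intro sets.countable_INT') (auto simp: sets_last_meeting)
    have "emeasure ?P A \<le> (INF N. \<integral>\<^sup>+w. ?f N w \<partial>srw_pos G v n)"
      unfolding emeasure_last_meeting[symmetric]
      by (intro INF_greatest emeasure_mono) (auto simp: A_def sets_srw_law_pair sets_last_meeting)
    \<comment> \<open>Monotone convergence from above, legitimate because the integral for
      \<open>N = 0\<close> is at most 1.\<close>
    also have "\<dots> = (\<integral>\<^sup>+w. (INF N. ?f N w) \<partial>srw_pos G v n)"
    proof (rule nn_integral_monotone_convergence_INF_decseq[symmetric, where i = 0])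
      show "decseq ?f"
        by (intro decseq_SucI le_funI mult_left_mono meet_free_antimono) auto
      have "(\<integral>\<^sup>+w. ?f 0 w \<partial>srw_pos G v n) \<le> (\<integral>\<^sup>+w. 1 * 1 \<partial>srw_pos G v n)"
        by (intro nn_integral_mono mult_mono meet_free_le_1) (auto simp: pmf_le_1)
      also have "\<dots> < \<infinity>" by simp
      finally show "(\<integral>\<^sup>+w. ?f 0 w \<partial>srw_pos G v n) < \<infinity>" .
    qed simp
    also have "\<dots> = (\<integral>\<^sup>+w. 0 \<partial>srw_pos G v n)"
    proof (rule nn_integral_cong_AE, unfold AE_measure_pmf_iff, rule ballI)
      fix w assume "w \<in> set_pmf (srw_pos G v n)"
      then have w: "(INF N. meet_free G N w) = 0"
        using set_srw_pos[OF G v] zero by blast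
      have "(INF N. ?f N w) \<le> (INF N. meet_free G N w)"
      proof (intro INF_mono bexI)
        fix N
        have "?f N w \<le> 1 * meet_free G N w"
          by (intro mult_right_mono) (auto simp: pmf_le_1)
        then show "?f N w \<le> meet_free G N w" by simp
      qed auto
      then show "(INF N. ?f N w) = 0" by (simp add: w)
    qed
    finally have "A \<in> null_sets ?P"
      using A by auto
    then have "AE p in ?P. p \<notin> A"
      by (rule AE_not_in)
    then show ?thesis
      by eventually_elim (fastforce simp: A_def last_meeting_def)
  qed
  then have "AE p in ?P. \<forall>n. \<not> (fst p n = snd p n \<and> (\<forall>k\<ge>1. fst p (n + k) \<noteq> snd p (n + k)))"
    by (subst AE_all_countable) blast
  moreover have "AE p in ?P. fst p 0 = v \<and> snd p 0 = v"
  proof -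
    interpret L: prob_space "srw_law G v" by (rule prob_space_srw_law)
    interpret PP: pair_prob_space "srw_law G v" "srw_law G v" ..
    have x0: "(\<lambda>x. x 0) \<in> traj \<rightarrow>\<^sub>M count_space UNIV"
      by simp
    have "Measurable.pred (traj \<Otimes>\<^sub>M traj) (\<lambda>p. fst p 0 = v \<and> snd p 0 = v)"
      by (intro pred_intros_logic pred_count_space_const1
          measurable_compose[OF measurable_fst x0] measurable_compose[OF measurable_snd x0])
    then have "{p \<in> space ?P. fst p 0 = v \<and> snd p 0 = v} \<in> sets ?P"
      unfolding sets_eq_imp_space_eq[OF sets_srw_law_pair] sets_srw_law_pair by (rule predE)
    from PP.AE_pair_measure[OF this] show ?thesis
      using AE_srw_start[where G=G and v=v] by (auto elim!: eventually_mono)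
  qed
  ultimately have "AE p in ?P. \<exists>\<^sub>\<infinity>n. fst p n = snd p n"
  proof eventually_elim
    \<comment> \<open>Starting from the meeting at time 0, each meeting produces a later one, so
      meeting times are unbounded.\<close>
    case (elim p)
    have "\<exists>n\<ge>N. fst p n = snd p n" for N
    proof (induction N)
      case 0
      then show ?case using elim(2) by (intro exI[of _ 0]) simp
    next
      case (Suc N)
      then obtain n where "n \<ge> N" "fst p n = snd p n" by auto
      moreover from this obtain k where "k \<ge> 1" "fst p (n + k) = snd p (n + k)"
        using elim(1) by auto
      ultimately show ?case by (intro exI[of _ "n + k"]) auto
    qed
    then show ?case by (simp add: INFM_nat_le)
  qed
  then show "AE (x, y) in ?P. \<exists>\<^sub>\<infinity>n. x n = y n"
    by (simp add: case_prod_beta)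
qed

section \<open>Dependence on balls\<close>

lemma vball_mono: "S \<subseteq> T \<Longrightarrow> vball G S r \<subseteq> vball G T r"
  by (induction r) auto

lemma vball_add: "vball G (vball G S m) n = vball G S (m + n)"
  by (induction n) auto

lemma vball_radius_mono: "m \<le> n \<Longrightarrow> vball G S m \<subseteq> vball G S n"
  using subset_vball[of "vball G S m" G "n - m"] by (simp add: vball_add)

lemma adj_induced: "adj (induced G U) u v \<longleftrightarrow> adj G u v \<and> u \<in> U \<and> v \<in> U"
proof
  assume "adj G u v \<and> u \<in> U \<and> v \<in> U"
  then obtain e where "e \<in> edges G" "ends G e = {u, v}" "ends G e \<subseteq> U"
    by (auto simp: adj_def)
  then show "adj (induced G U) u v"
    unfolding adj_def by (intro bexI[of _ e]) (simp_all add: induced_def)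
qed (auto simp: adj_def induced_def)

lemma vball_induced: "vball G S r \<subseteq> U \<Longrightarrow> vball (induced G U) S r = vball G S r"
proof (induction r)
  case (Suc r)
  then have IH: "vball (induced G U) S r = vball G S r"
    by auto
  have "adj (induced G U) u v \<longleftrightarrow> adj G u v" if "u \<in> vball G S r" for u v
  proof -
    have "u \<in> U" "v \<in> U" if "adj G u v"
      using Suc.prems \<open>u \<in> vball G S r\<close> that by auto
    then show ?thesis
      by (auto simp: adj_induced)
  qed
  then show ?case
    by (auto simp: IH)
qed simp

lemma induced_induced: "V \<subseteq> U \<Longrightarrow> induced (induced G U) V = induced G V"
  by (auto simp: induced_def)

lemma locally_finite_induced:
  "locally_finite G \<Longrightarrow> U \<subseteq> verts G \<Longrightarrow> locally_finite (induced G U)"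
  by (auto simp: locally_finite_def induced_def edges_at_def
      intro: rev_finite_subset[of "{e \<in> edges G. _ \<in> ends G e}"])

lemma set_srw_step_adj:
  assumes "wf_multigraph G" "locally_finite G" "u \<in> verts G" "v \<in> set_pmf (srw_step G u)"
  shows "v = u \<or> adj G u v"
proof (cases "edges_at G u = {}")
  case True
  then show ?thesis using assms(4) by (simp add: srw_step_def)
next
  case False
  have "finite (edges_at G u)"
    using assms by (simp add: locally_finite_def)
  moreover have "pmf (srw_step G u) v \<noteq> 0"
    using assms(4) by (simp add: set_pmf_iff)
  ultimately have "card {e \<in> edges G. ends G e = {u, v}} \<noteq> 0"
    unfolding pmf_srw_step[OF assms(1-3) False] by simp
  then have "{e \<in> edges G. ends G e = {u, v}} \<noteq> {}"
    by (metis card.empty)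
  then show ?thesis
    by (auto simp: adj_def)
qed

text \<open>Every edge at \<open>u\<close> survives in the induced graph when all neighbours of
  \<open>u\<close> do.\<close>

lemma srw_step_induced:
  assumes "wf_multigraph G" "u \<in> U" "{v. adj G u v} \<subseteq> U"
  shows "srw_step (induced G U) u = srw_step G u"
proof -
  have "ends G e \<subseteq> U" if e: "e \<in> edges_at G u" for e
  proof -
    obtain v where v: "ends G e = {u, v}"
      using e assms(1) by (fastforce simp: edges_at_def wf_multigraph_def)
    then have "adj G u v"
      using e by (auto simp: adj_def edges_at_def)
    then show ?thesis
      using v assms by auto
  qed
  then have "edges_at (induced G U) u = edges_at G u"
    by (auto simp: edges_at_def induced_def)
  then show ?thesis
    by (simp add: srw_step_def induced_def)
qed

text \<open>A prefix with \<open>n\<close> entries makes \<open>n - 1\<close> steps, hence the bound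
  \<open>Suc r\<close>. The second claim is proved along with the first, which needs it: before each
  step the walk is so far inside the ball that all neighbours of its position belong to the
  ball.\<close>

lemma srw_prefix_induced:
  assumes G: "wf_multigraph G" "locally_finite G" and S: "S \<subseteq> verts G" and v: "v \<in> S"
    and n: "n \<le> Suc r"
  shows "srw_prefix (induced G (vball G S r)) v n = srw_prefix G v n \<and>
    (\<forall>xs\<in>set_pmf (srw_prefix G v n). \<forall>i<n. xs ! i \<in> vball G S i)"
  using n
proof (induction n)
  case (Suc n)
  let ?H = "induced G (vball G S r)"
  from Suc have IH: "srw_prefix ?H v n = srw_prefix G v n"
    and ball: "\<And>xs i. xs \<in> set_pmf (srw_prefix G v n) \<Longrightarrow> i < n \<Longrightarrow> xs ! i \<in> vball G S i"
    by auto
  have last: "last xs \<in> vball G S m" if "xs \<in> set_pmf (srw_prefix G v n)" "n = Suc m" for xs m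
    using ball[OF that(1), of m] length_srw_prefix[OF that(1)] that(2)
    by (subst last_conv_nth) auto
  have step: "srw_step ?H (last xs) = srw_step G (last xs)"
    if "xs \<in> set_pmf (srw_prefix G v n)" "n = Suc m" for xs m
  proof (rule srw_step_induced[OF G(1)])
    have "vball G S m \<subseteq> vball G S r" "vball G S (Suc m) \<subseteq> vball G S r"
      using Suc.prems that(2) by (auto intro!: vball_radius_mono simp del: vball.simps)
    then show "last xs \<in> vball G S r" "{w. adj G (last xs) w} \<subseteq> vball G S r"
      using last[OF that] by auto
  qed
  have "srw_prefix ?H v (Suc n) = srw_prefix G v (Suc n)"
    unfolding srw_prefix.simps IH using step by (intro bind_pmf_cong refl) (cases n; simp)
  moreover have "ys ! i \<in> vball G S i" if ys: "ys \<in> set_pmf (srw_prefix G v (Suc n))" and i: "i < Suc n" for ys i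
  proof -
    obtain xs y where xs: "xs \<in> set_pmf (srw_prefix G v n)" "ys = xs @ [y]"
      and y: "y \<in> set_pmf (if n = 0 then return_pmf v else srw_step G (last xs))"
      using ys by auto
    have len: "length xs = n"
      using xs(1) by (rule length_srw_prefix)
    show ?thesis
    proof (cases "i < n")
      case True
      then show ?thesis
        using ball[OF xs(1)] by (simp add: xs(2) nth_append len)
    next
      case False
      with i have i: "i = n" by simp
      have "y \<in> vball G S n"
      proof (cases n)
        case 0
        then show ?thesis using y v by simp
      next
        case (Suc m)
        have "last xs \<in> vball G S m"
          by (rule last[OF xs(1) Suc])
        moreover from this have "last xs \<in> verts G"
          using vball_subset[OF G(1) S] by blast
        then have "y = last xs \<or> adj G (last xs) y"
          using y Suc by (intro set_srw_step_adj[OF G]) auto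
        ultimately show ?thesis
          using Suc by auto
      qed
      then show ?thesis
        by (simp add: xs(2) i len nth_append)
    qed
  qed
  ultimately show ?case by blast
qed simp

lemma set_srw_pos_vball:
  assumes G: "wf_multigraph G" "locally_finite G" and v: "v \<in> verts G" and w: "w \<in> set_pmf (srw_pos G v n)"
  shows "w \<in> vball G {v} n"
proof -
  obtain xs where xs: "xs \<in> set_pmf (srw_prefix G v (Suc n))" "w = last xs"
    using w by (auto simp: srw_pos_def simp del: srw_prefix.simps)
  moreover have "length xs = Suc n"
    using xs(1) by (rule length_srw_prefix)
  moreover have "xs ! n \<in> vball G {v} n"
    using srw_prefix_induced[OF G, of "{v}" v "Suc n" n] v xs(1) by (auto simp del: srw_prefix.simps)
  ultimately show ?thesis
    by (metis diff_Suc_1 last_conv_nth length_0_conv nat.distinct(1))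
qed

section \<open>Walks carried over by isomorphisms of balls\<close>

lemma pmf_map_inj_on:
  assumes f: "inj_on f U" and p: "set_pmf p \<subseteq> U" and x: "x \<in> U"
  shows "pmf (map_pmf f p) (f x) = pmf p x"
proof -
  have "measure_pmf.prob p (f -` {f x}) = measure_pmf.prob p {x}"
    using p x inj_onD[OF f] by (intro measure_pmf.finite_measure_eq_AE) (auto simp: AE_measure_pmf_iff)
  then show ?thesis
    by (simp add: pmf_map measure_pmf_single)
qed

text \<open>For \<open>r\<close> steps the walk from a root does not notice the restriction to the
  ball, neither in \<open>G\<close> nor in \<open>H\<close>, and between the two balls the
  isomorphism carries it over.\<close>

lemma same_balls_srw:
  assumes iso: "same_balls r G R H S"
    and G: "wf_multigraph G" "locally_finite G" "set R \<subseteq> verts G"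
    and H: "wf_multigraph H" "locally_finite H" "set S \<subseteq> verts H"
  obtains f g where
    "graph_iso f g (induced G (vball G (set R) r)) (induced H (vball H (set S) r))"
    "map f R = S" "inj_on f (vball G (set R) r)"
    "\<And>v m. v \<in> set R \<Longrightarrow> m \<le> Suc r \<Longrightarrow> srw_prefix H (f v) m = map_pmf (map f) (srw_prefix G v m)"
    "\<And>v m xs. v \<in> set R \<Longrightarrow> m \<le> Suc r \<Longrightarrow> xs \<in> set_pmf (srw_prefix G v m) \<Longrightarrow> set xs \<subseteq> vball G (set R) r"
proof -
  let ?U = "vball G (set R) r" and ?W = "vball H (set S) r"
  obtain f g where fg: "graph_iso f g (induced G ?U) (induced H ?W)" "map f R = S"
    using iso by (auto simp: same_balls_def marked_iso_def)
  have U: "?U \<subseteq> verts G" "set R \<subseteq> ?U"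
    using vball_subset[OF G(1,3)] subset_vball by auto
  have inj: "inj_on f ?U"
    using fg(1) by (simp add: graph_iso_def bij_betw_def induced_def)
  have pre: "srw_prefix H (f v) m = map_pmf (map f) (srw_prefix G v m)"
    if v: "v \<in> set R" and m: "m \<le> Suc r" for v m
  proof -
    have "f v \<in> set S"
      using v fg(2) by auto
    then have "srw_prefix H (f v) m = srw_prefix (induced H ?W) (f v) m"
      using srw_prefix_induced[OF H _ m] by simp
    also have "\<dots> = map_pmf (map f) (srw_prefix (induced G ?U) v m)"
      using U v by (intro srw_prefix_iso[OF fg(1)] wf_induced locally_finite_induced G) (auto simp: induced_def)
    also have "srw_prefix (induced G ?U) v m = srw_prefix G v m"
      using srw_prefix_induced[OF G v m] by simp
    finally show ?thesis .
  qed
  have sub: "set xs \<subseteq> ?U" if v: "v \<in> set R" and m: "m \<le> Suc r" and xs: "xs \<in> set_pmf (srw_prefix G v m)" for v m xs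
  proof
    fix x assume "x \<in> set xs"
    then obtain i where i: "i < length xs" "x = xs ! i"
      by (auto simp: in_set_conv_nth)
    then have "i < m"
      using length_srw_prefix[OF xs] by simp
    then have "x \<in> vball G (set R) i"
      using srw_prefix_induced[OF G v m] xs i by auto
    moreover have "vball G (set R) i \<subseteq> ?U"
      using m \<open>i < m\<close> by (intro vball_radius_mono) simp
    ultimately show "x \<in> ?U" by blast
  qed
  show thesis
    by (rule that[OF fg inj pre sub])
qed

lemma meet_free_prefix:
  "meet_free G N v = (\<integral>\<^sup>+xs. \<integral>\<^sup>+ys. of_bool (\<forall>k\<in>{1..N}. xs ! k \<noteq> ys ! k)
     \<partial>srw_prefix G v (Suc N) \<partial>srw_prefix G v (Suc N))"
proof -
  let ?pre = "\<lambda>x. map x [0..<Suc N]"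
  have p: "?pre \<in> srw_law G v \<rightarrow>\<^sub>M count_space UNIV"
    using measurable_prefix[of "Suc N" UNIV] by (simp add: measurable_cong_sets[OF sets_srw_law refl] del: upt_Suc)
  have "meet_free G N v = (\<integral>\<^sup>+x. \<integral>\<^sup>+y. of_bool (\<forall>k\<in>{1..N}. ?pre x ! k \<noteq> ?pre y ! k) \<partial>srw_law G v \<partial>srw_law G v)"
    unfolding meet_free_def emeasure_srw_law_pair[OF sets_meet_free]
    by (intro nn_integral_cong) (auto simp: indicator_def simp del: upt_Suc)
  also have "\<dots> = (\<integral>\<^sup>+x. \<integral>\<^sup>+ys. of_bool (\<forall>k\<in>{1..N}. ?pre x ! k \<noteq> ys ! k) \<partial>srw_prefix G v (Suc N) \<partial>srw_law G v)"
    unfolding distr_srw_prefix[symmetric]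
    by (intro nn_integral_cong nn_integral_distr[OF p, symmetric]) simp
  also have "\<dots> = (\<integral>\<^sup>+xs. \<integral>\<^sup>+ys. of_bool (\<forall>k\<in>{1..N}. xs ! k \<noteq> ys ! k)
     \<partial>srw_prefix G v (Suc N) \<partial>srw_prefix G v (Suc N))"
    unfolding distr_srw_prefix[of G v "Suc N", symmetric]
    by (subst (2) nn_integral_distr[OF p]) simp_all
  finally show ?thesis .
qed

text \<open>A relabelling that is injective on the visited vertices neither creates nor destroys
  meetings.\<close>

lemma meet_free_map:
  assumes eq: "srw_prefix H w (Suc N) = map_pmf (map f) (srw_prefix G v (Suc N))"
    and f: "inj_on f U" and sub: "\<And>xs. xs \<in> set_pmf (srw_prefix G v (Suc N)) \<Longrightarrow> set xs \<subseteq> U"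
  shows "meet_free H N w = meet_free G N v"
  unfolding meet_free_prefix eq nn_integral_map_pmf
proof (intro nn_integral_cong_AE, unfold AE_measure_pmf_iff, intro ballI nn_integral_cong_AE, unfold AE_measure_pmf_iff, intro ballI)
  fix xs ys assume xs: "xs \<in> set_pmf (srw_prefix G v (Suc N))" and ys: "ys \<in> set_pmf (srw_prefix G v (Suc N))"
  have "map f xs ! k \<noteq> map f ys ! k \<longleftrightarrow> xs ! k \<noteq> ys ! k" if "k \<in> {1..N}" for k
  proof -
    have "k < length xs" "k < length ys"
      using that length_srw_prefix[OF xs] length_srw_prefix[OF ys] by auto
    moreover from this have "xs ! k \<in> U" "ys ! k \<in> U"
      using sub[OF xs] sub[OF ys] nth_mem by blast+
    ultimately show ?thesis
      using inj_on_eq_iff[OF f] by simp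
  qed
  then show "of_bool (\<forall>k\<in>{1..N}. map f xs ! k \<noteq> map f ys ! k) = (of_bool (\<forall>k\<in>{1..N}. xs ! k \<noteq> ys ! k) :: ennreal)"
    by (intro arg_cong[where f=of_bool]) blast
qed

section \<open>Functionals determined by a ball\<close>

text \<open>Marking a graph by a list treats one and two roots alike. Isomorphic marked graphs have
  the same balls, so such a functional is also invariant under isomorphism.\<close>

definition local_functional :: "nat \<Rightarrow> (multigraph \<Rightarrow> nat list \<Rightarrow> 'b) \<Rightarrow> bool" where
  "local_functional r F \<longleftrightarrow> (\<forall>G R H S. conn_lf_multigraph G \<and> set R \<subseteq> verts G \<and>
     conn_lf_multigraph H \<and> set S \<subseteq> verts H \<and> R \<noteq> [] \<and> same_balls r G R H S \<longrightarrow> F G R = F H S)"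

lemma local_functionalD:
  assumes "local_functional r F" "same_balls r G R H S"
    "conn_lf_multigraph G" "set R \<subseteq> verts G" "conn_lf_multigraph H" "set S \<subseteq> verts H" "R \<noteq> []"
  shows "F G R = F H S"
  using assms unfolding local_functional_def by blast

text \<open>Around marks within distance \<open>n\<close> of \<open>R\<close>, balls of radius
  \<open>r\<close> stay inside the ball of radius \<open>n + r\<close> around \<open>R\<close>, so
  the isomorphism of the large balls restricts to them.\<close>

lemma same_balls_sub:
  assumes iso: "graph_iso f g (induced G (vball G (set R) (n + r))) (induced H (vball H (set S) (n + r)))"
    and S: "map f R = S" and G: "wf_multigraph G" "set R \<subseteq> verts G"
    and H: "wf_multigraph H" "set S \<subseteq> verts H" and T: "set T \<subseteq> vball G (set R) n"
  shows "same_balls r G T H (map f T)"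
proof -
  let ?U = "vball G (set R) (n + r)" and ?W = "vball H (set S) (n + r)"
  have U: "vball G (set R) n \<subseteq> ?U" and W: "vball H (set S) n \<subseteq> ?W"
    by (simp_all add: vball_radius_mono)
  have "vball (induced H ?W) (f ` set R) n = f ` vball (induced G ?U) (set R) n"
    using subset_vball[of "set R" G] by (intro vball_iso[OF iso] wf_induced G) (simp add: induced_def)
  then have "vball H (set S) n = f ` vball G (set R) n"
    using S vball_induced[OF U] vball_induced[OF W] by auto
  then have "f ` set T \<subseteq> vball H (set S) n"
    using T by auto
  then have TW: "vball H (f ` set T) r \<subseteq> ?W"
    using vball_mono by (metis vball_add)
  have TU: "vball G (set T) r \<subseteq> ?U"
    using T vball_mono by (metis vball_add)
  have "marked_iso (induced G ?U) T (induced H ?W) (map f T)"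
    using iso by (auto simp: marked_iso_def)
  \<comment> \<open>The small balls are first compared inside the large ones; afterwards the outer
    restriction is removed, since it does not change them.\<close>
  then have "same_balls r (induced G ?U) T (induced H ?W) (map f T)"
    using T U by (rule_tac marked_iso_vball) (auto simp: wf_induced G, auto simp: induced_def)
  then show ?thesis
    by (simp add: same_balls_def vball_induced[OF TU] vball_induced[OF TW] induced_induced TU TW)
qed

lemma local_functional_mono:
  assumes F: "local_functional r F" and "r \<le> s"
  shows "local_functional s F"
  unfolding local_functional_def
proof (intro allI impI, elim conjE)
  fix G R H S
  assume *: "conn_lf_multigraph G" "set R \<subseteq> verts G" "conn_lf_multigraph H" "set S \<subseteq> verts H" "R \<noteq> []"
    and "same_balls s G R H S"
  then obtain f g where fg: "graph_iso f g (induced G (vball G (set R) s)) (induced H (vball H (set S) s))" "map f R = S"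
    by (auto simp: same_balls_def marked_iso_def)
  have "same_balls r G R H (map f R)"
    using fg * \<open>r \<le> s\<close> subset_vball[of "set R" G "s - r"]
    by (intro same_balls_sub[where n = "s - r" and S = S and g = g]) (auto simp: conn_lf_multigraph_def)
  then show "F G R = F H S"
    using local_functionalD[OF F] * fg(2) by blast
qed

lemma local_functional_comp2:
  "local_functional r F \<Longrightarrow> local_functional r F' \<Longrightarrow> local_functional r (\<lambda>G R. h (F G R) (F' G R))"
  unfolding local_functional_def by metis

lemma local_functional_comp: "local_functional r F \<Longrightarrow> local_functional r (\<lambda>G R. h (F G R))"
  unfolding local_functional_def by metis

text \<open>The ball depends on the set of marks, not on their order. This exchanges the two roots,
  and also passes from \<open>hd\<close> to \<open>last\<close>.\<close>

lemma local_functional_rev: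
  assumes "local_functional r F"
  shows "local_functional r (\<lambda>G R. F G (rev R))"
proof -
  have "same_balls r G (rev R) H (rev S)" if "same_balls r G R H S" for G R H S
    using that by (auto simp: same_balls_def marked_iso_def rev_map)
  with assms show ?thesis
    unfolding local_functional_def by (metis set_rev rev_is_Nil_conv)
qed

lemma srw_pos_map:
  assumes "srw_prefix H w (Suc n) = map_pmf (map f) (srw_prefix G v (Suc n))"
  shows "srw_pos H w n = map_pmf f (srw_pos G v n)"
proof -
  have "map_pmf last (map_pmf (map f) (srw_prefix G v (Suc n))) = map_pmf (f \<circ> last) (srw_prefix G v (Suc n))"
    unfolding pmf.map_comp
  proof (intro map_pmf_cong refl)
    fix xs assume "xs \<in> set_pmf (srw_prefix G v (Suc n))"
    then have "xs \<noteq> []"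
      using length_srw_prefix by fastforce
    then show "(last \<circ> map f) xs = (f \<circ> last) xs"
      by (simp add: last_map)
  qed
  then show ?thesis
    by (simp add: srw_pos_def assms pmf.map_comp del: srw_prefix.simps)
qed

text \<open>For two marks this is a transition probability, for a single mark the return
  probability, as \<open>hd\<close> and \<open>last\<close> then coincide.\<close>

lemma local_functional_pmf: "local_functional n (\<lambda>G R. pmf (srw_pos G (hd R) n) (last R))"
  unfolding local_functional_def
proof (intro allI impI, elim conjE)
  fix G R H S
  assume G: "conn_lf_multigraph G" "set R \<subseteq> verts G" and H: "conn_lf_multigraph H" "set S \<subseteq> verts H"
    and R: "R \<noteq> []" and iso: "same_balls n G R H S"
  obtain f g where fg: "map f R = S" "inj_on f (vball G (set R) n)"
    "\<And>v m. v \<in> set R \<Longrightarrow> m \<le> Suc n \<Longrightarrow> srw_prefix H (f v) m = map_pmf (map f) (srw_prefix G v m)"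
    using same_balls_srw[OF iso] G H unfolding conn_lf_multigraph_def by metis
  have "srw_pos H (f (hd R)) n = map_pmf f (srw_pos G (hd R) n)"
    using R by (intro srw_pos_map fg) auto
  moreover have "set_pmf (srw_pos G (hd R) n) \<subseteq> vball G (set R) n"
  proof
    fix w assume "w \<in> set_pmf (srw_pos G (hd R) n)"
    then have "w \<in> vball G {hd R} n"
      using G R by (intro set_srw_pos_vball) (auto simp: conn_lf_multigraph_def)
    then show "w \<in> vball G (set R) n"
      using vball_mono[of "{hd R}" "set R"] R by auto
  qed
  moreover have "last R \<in> vball G (set R) n"
    using R subset_vball last_in_set by blast
  ultimately show "pmf (srw_pos G (hd R) n) (last R) = pmf (srw_pos H (hd S) n) (last S)"
    using R fg(1) pmf_map_inj_on[OF fg(2)] by (auto simp: hd_map last_map)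
qed

lemma local_functional_meet_free: "local_functional N (\<lambda>G R. meet_free G N (hd R))"
  unfolding local_functional_def
proof (intro allI impI, elim conjE)
  fix G R H S
  assume G: "conn_lf_multigraph G" "set R \<subseteq> verts G" and H: "conn_lf_multigraph H" "set S \<subseteq> verts H"
    and R: "R \<noteq> []" and iso: "same_balls N G R H S"
  obtain f g where fg: "map f R = S" "inj_on f (vball G (set R) N)"
    "\<And>v m. v \<in> set R \<Longrightarrow> m \<le> Suc N \<Longrightarrow> srw_prefix H (f v) m = map_pmf (map f) (srw_prefix G v m)"
    "\<And>v m xs. v \<in> set R \<Longrightarrow> m \<le> Suc N \<Longrightarrow> xs \<in> set_pmf (srw_prefix G v m) \<Longrightarrow> set xs \<subseteq> vball G (set R) N"
    using same_balls_srw[OF iso] G H unfolding conn_lf_multigraph_def by metis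
  have "meet_free H N (f (hd R)) = meet_free G N (hd R)"
    by (rule meet_free_map[OF fg(3)[OF hd_in_set[OF R] order_refl] fg(2) fg(4)[OF hd_in_set[OF R] order_refl]])
  then show "meet_free G N (hd R) = meet_free H N (hd S)"
    using R fg(1) by (auto simp: hd_map)
qed

text \<open>The walk is within distance \<open>n\<close> of the root at time \<open>n\<close>, so a
  functional of radius \<open>r\<close> in its position sees at most the ball of radius
  \<open>n + r\<close>.\<close>

lemma local_functional_integral:
  fixes F :: "multigraph \<Rightarrow> nat list \<Rightarrow> ennreal"
  assumes F: "local_functional r F"
  shows "local_functional (n + r) (\<lambda>G R. \<integral>\<^sup>+v. F G [hd R, v] \<partial>srw_pos G (hd R) n)"
  unfolding local_functional_def
proof (intro allI impI, elim conjE)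
  fix G R H S
  assume G: "conn_lf_multigraph G" "set R \<subseteq> verts G" and H: "conn_lf_multigraph H" "set S \<subseteq> verts H"
    and R: "R \<noteq> []" and iso: "same_balls (n + r) G R H S"
  then have wf: "wf_multigraph G" "locally_finite G" "wf_multigraph H" "locally_finite H"
    by (auto simp: conn_lf_multigraph_def)
  obtain f g where fg:
    "graph_iso f g (induced G (vball G (set R) (n + r))) (induced H (vball H (set S) (n + r)))"
    "map f R = S"
    "\<And>v m. v \<in> set R \<Longrightarrow> m \<le> Suc (n + r) \<Longrightarrow> srw_prefix H (f v) m = map_pmf (map f) (srw_prefix G v m)"
    using same_balls_srw[OF iso wf(1,2) G(2) wf(3,4) H(2)] by metis
  have hd: "hd R \<in> set R" "hd S = f (hd R)"
    using R fg(2) by (auto simp: hd_map)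
  then have hdv: "hd R \<in> verts G" using G by auto
  have pos: "srw_pos H (hd S) n = map_pmf f (srw_pos G (hd R) n)"
    unfolding hd(2) using hd(1) by (intro srw_pos_map fg) auto
  have "F G [hd R, v] = F H [f (hd R), f v]" if v: "v \<in> set_pmf (srw_pos G (hd R) n)" for v
  proof -
    have "v \<in> vball G {hd R} n"
      by (rule set_srw_pos_vball[OF wf(1,2) hdv v])
    then have "v \<in> vball G (set R) n"
      using vball_mono[of "{hd R}" "set R"] hd by auto
    then have "set [hd R, v] \<subseteq> vball G (set R) n"
      using hd subset_vball by auto
    from same_balls_sub[OF fg(1,2) wf(1) G(2) wf(3) H(2) this]
    have "same_balls r G [hd R, v] H [f (hd R), f v]" by simp
    moreover have "f v \<in> set_pmf (srw_pos H (hd S) n)"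
      using v by (simp add: pos)
    moreover have "hd S \<in> verts H"
      using hd H(2) fg(2) by auto
    ultimately show ?thesis
      using set_srw_pos[OF wf(1,2) hdv] set_srw_pos[OF wf(3,4), of "hd S"] v hdv hd G(1) H(1)
      by (intro local_functionalD[OF F]) auto
  qed
  then show "(\<integral>\<^sup>+v. F G [hd R, v] \<partial>srw_pos G (hd R) n) = (\<integral>\<^sup>+v. F H [hd S, v] \<partial>srw_pos H (hd S) n)"
    unfolding pos nn_integral_map_pmf unfolding hd(2)
    by (intro nn_integral_cong_AE) (simp add: AE_measure_pmf_iff)
qed

section \<open>Transport on random rooted graphs\<close>

text \<open>Evaluation at an arbitrary representative of the isomorphism class; for local
  functionals the choice does not matter.\<close>

definition eval_rooted :: "(multigraph \<Rightarrow> nat list \<Rightarrow> 'b) \<Rightarrow> rooted_graph \<Rightarrow> 'b" where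
  "eval_rooted F x = (case rep_rooted_graph x of (G, u) \<Rightarrow> F G [u])"

definition eval_birooted :: "(multigraph \<Rightarrow> nat list \<Rightarrow> 'b) \<Rightarrow> birooted_graph \<Rightarrow> 'b" where
  "eval_birooted F z = (case rep_birooted_graph z of (G, u, v) \<Rightarrow> F G [u, v])"

lemma rep_rooted_graph:
  assumes "rep_rooted_graph x = (G, u)"
  shows "conn_lf_multigraph G" "u \<in> verts G"
  using Quotient_rep_reflp[OF Quotient_rooted_graph, of x] assms by auto

lemma rep_birooted_graph:
  assumes "rep_birooted_graph z = (G, u, v)"
  shows "conn_lf_multigraph G" "u \<in> verts G" "v \<in> verts G"
  using Quotient_rep_reflp[OF Quotient_birooted_graph, of z] assms by auto

lemma same_balls_refl: "same_balls r G R G R"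
  by (simp add: same_balls_def marked_iso_refl)

text \<open>Any preimage is a union of sets of graphs with a prescribed ball, hence open, whatever
  the sigma-algebra of \<open>N\<close>.\<close>

lemma measurable_eval_rooted:
  assumes F: "local_functional r F" and N: "space N = UNIV"
  shows "eval_rooted F \<in> borel \<rightarrow>\<^sub>M N"
proof (rule measurableI)
  fix A
  have inv: "eval_rooted F x = eval_rooted F y" if "same_rooted_balls r x y" for x y
    using that rep_rooted_graph[of x] rep_rooted_graph[of y]
    by (auto simp: eval_rooted_def same_rooted_balls.rep_eq split: prod.splits intro!: local_functionalD[OF F])
  have refl: "same_rooted_balls r x x" for x
    by (simp add: same_rooted_balls.rep_eq same_balls_refl split: prod.splits)
  have "eval_rooted F -` A = (\<Union>x\<in>eval_rooted F -` A. {y. same_rooted_balls r x y})"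
    using inv refl by fastforce
  moreover have "open {y. same_rooted_balls r x y}" for x
    unfolding open_rooted_graph_def by (rule generate_topology.Basis) blast
  ultimately have "open (eval_rooted F -` A)"
    by (metis (no_types, lifting) open_UN)
  then show "eval_rooted F -` A \<inter> space borel \<in> sets borel"
    by simp
qed (simp add: N)

lemma measurable_eval_birooted:
  assumes F: "local_functional r F" and N: "space N = UNIV"
  shows "eval_birooted F \<in> borel \<rightarrow>\<^sub>M N"
proof (rule measurableI)
  fix A
  have inv: "eval_birooted F x = eval_birooted F y" if "same_birooted_balls r x y" for x y
    using that rep_birooted_graph[of x] rep_birooted_graph[of y]
    by (auto simp: eval_birooted_def same_birooted_balls.rep_eq split: prod.splits intro!: local_functionalD[OF F])
  have refl: "same_birooted_balls r x x" for x
    by (simp add: same_birooted_balls.rep_eq same_balls_refl split: prod.splits)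
  have "eval_birooted F -` A = (\<Union>x\<in>eval_birooted F -` A. {y. same_birooted_balls r x y})"
    using inv refl by fastforce
  moreover have "open {y. same_birooted_balls r x y}" for x
    unfolding open_birooted_graph_def by (rule generate_topology.Basis) blast
  ultimately have "open (eval_birooted F -` A)"
    by (metis (no_types, lifting) open_UN)
  then show "eval_birooted F -` A \<inter> space borel \<in> sets borel"
    by simp
qed (simp add: N)

lemma eval_birooted_abs:
  assumes F: "local_functional r F" and G: "conn_lf_multigraph G" "u \<in> verts G" "v \<in> verts G"
  shows "eval_birooted F (abs_birooted_graph (G, u, v)) = F G [u, v]"
proof -
  let ?z = "abs_birooted_graph (G, u, v)"
  obtain H u' v' where rep: "rep_birooted_graph ?z = (H, u', v')"
    by (metis prod_cases3)
  have "birooted_eq (G, u, v) (G, u, v)"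
    using G by (simp add: marked_iso_refl)
  then have "birooted_eq (rep_birooted_graph ?z) (G, u, v)"
    using Quotient_rep_abs[OF Quotient_birooted_graph] by blast
  then have "conn_lf_multigraph H" "u' \<in> verts H" "v' \<in> verts H" "marked_iso H [u', v'] G [u, v]"
    by (auto simp: rep)
  then have "F H [u', v'] = F G [u, v]"
    using G by (intro local_functionalD[OF F] marked_iso_vball) (auto simp: conn_lf_multigraph_def)
  then show ?thesis
    by (simp add: eval_birooted_def rep)
qed

text \<open>Translates the two laws compared by \<open>reversible\<close> into integrals over the
  position of the walk on a representative.\<close>

lemma emeasure_walk_laws:
  assumes F: "local_functional r F" and A: "A \<in> sets N" and N: "space N = UNIV"
    and x: "rep_rooted_graph x = (G, u)"
  shows "emeasure (root_walk_law n x) (eval_birooted F -` A) = (\<integral>\<^sup>+v. indicator A (F G [u, v]) \<partial>srw_pos G u n)"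
    and "emeasure (walk_root_law n x) (eval_birooted F -` A) = (\<integral>\<^sup>+v. indicator A (F G [v, u]) \<partial>srw_pos G u n)"
proof -
  note G = rep_rooted_graph[OF x]
  then have wf: "wf_multigraph G" "locally_finite G"
    by (auto simp: conn_lf_multigraph_def)
  have B: "eval_birooted F -` A \<in> sets borel"
    using measurable_sets[OF measurable_eval_birooted[OF F N] A] by simp
  \<comment> \<open>Both orders of the roots at once: \<open>c\<close> gives the doubly-rooted graph
    and \<open>R\<close> the corresponding list of marks.\<close>
  have *: "emeasure (distr (srw_law G u) borel (\<lambda>t. c (t n))) (eval_birooted F -` A) =
      (\<integral>\<^sup>+v. indicator A (F G (R v)) \<partial>srw_pos G u n)"
    if c: "\<And>v. v \<in> verts G \<Longrightarrow> eval_birooted F (c v) = F G (R v)" for c R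
  proof -
    have m: "(\<lambda>t. c (t n)) \<in> srw_law G u \<rightarrow>\<^sub>M borel"
      by (rule measurable_compose[OF measurable_pos_srw]) simp
    have "emeasure (distr (srw_law G u) borel (\<lambda>t. c (t n))) (eval_birooted F -` A) =
        (\<integral>\<^sup>+z. indicator (eval_birooted F -` A) z \<partial>distr (srw_law G u) borel (\<lambda>t. c (t n)))"
      using B by simp
    also have "\<dots> = (\<integral>\<^sup>+t. indicator (eval_birooted F -` A) (c (t n)) \<partial>srw_law G u)"
      using B by (intro nn_integral_distr[OF m]) simp
    also have "\<dots> = (\<integral>\<^sup>+t. indicator A (F G (R (t n))) \<partial>srw_law G u)"
      by (rule nn_integral_cong_AE, use AE_srw_in_verts[OF wf G(2)] in eventually_elim)
         (simp add: c indicator_def)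
    also have "\<dots> = (\<integral>\<^sup>+v. indicator A (F G (R v)) \<partial>srw_pos G u n)"
      unfolding distr_srw_pos[symmetric] by (rule nn_integral_distr[OF measurable_pos_srw, symmetric]) simp
    finally show ?thesis .
  qed
  show "emeasure (root_walk_law n x) (eval_birooted F -` A) = (\<integral>\<^sup>+v. indicator A (F G [u, v]) \<partial>srw_pos G u n)"
    using * [of "\<lambda>v. abs_birooted_graph (G, u, v)" "\<lambda>v. [u, v]"] eval_birooted_abs[OF F G(1,2)]
    by (simp add: root_walk_law.rep_eq x)
  show "emeasure (walk_root_law n x) (eval_birooted F -` A) = (\<integral>\<^sup>+v. indicator A (F G [v, u]) \<partial>srw_pos G u n)"
    using * [of "\<lambda>v. abs_birooted_graph (G, v, u)" "\<lambda>v. [v, u]"] eval_birooted_abs[OF F G(1) _ G(2)]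
    by (simp add: walk_root_law.rep_eq x)
qed

text \<open>Reversibility is the case of indicators of sets of values of \<open>F\<close>; linearity
  and monotone convergence extend it. The induction runs over functions \<open>h\<close> applied
  after \<open>F\<close>, so that every functional met on the way is again local and thus
  measurable.\<close>

lemma reversible_transport:
  fixes F :: "multigraph \<Rightarrow> nat list \<Rightarrow> ennreal" and \<Gamma> :: "'a \<Rightarrow> rooted_graph"
  assumes \<Gamma>: "\<Gamma> \<in> borel_measurable M" and rev: "reversible M \<Gamma>" and F: "local_functional r F"
  shows "(\<integral>\<^sup>+\<omega>. eval_rooted (\<lambda>G R. \<integral>\<^sup>+v. F G [hd R, v] \<partial>srw_pos G (hd R) n) (\<Gamma> \<omega>) \<partial>M) =
         (\<integral>\<^sup>+\<omega>. eval_rooted (\<lambda>G R. \<integral>\<^sup>+v. F G [v, hd R] \<partial>srw_pos G (hd R) n) (\<Gamma> \<omega>) \<partial>M)"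
proof -
  define I :: "(ennreal \<Rightarrow> ennreal) \<Rightarrow> rooted_graph \<Rightarrow> ennreal"
    where "I h = eval_rooted (\<lambda>G R. \<integral>\<^sup>+v. h (F G [hd R, v]) \<partial>srw_pos G (hd R) n)" for h
  define J :: "(ennreal \<Rightarrow> ennreal) \<Rightarrow> rooted_graph \<Rightarrow> ennreal"
    where "J h = eval_rooted (\<lambda>G R. \<integral>\<^sup>+v. h (F G [v, hd R]) \<partial>srw_pos G (hd R) n)" for h
  have I: "(\<lambda>\<omega>. I h (\<Gamma> \<omega>)) \<in> borel_measurable M" for h
    unfolding I_def
    by (rule measurable_compose[OF \<Gamma> measurable_eval_rooted[OF local_functional_integral]])
       (auto intro: local_functional_comp F)
  have J: "(\<lambda>\<omega>. J h (\<Gamma> \<omega>)) \<in> borel_measurable M" for h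
    \<comment> \<open>The exchanged arguments \<open>[v, hd R]\<close> are the reversal of
      \<open>[hd R, v]\<close>.\<close>
    unfolding J_def using local_functional_integral[OF local_functional_rev[OF local_functional_comp[OF F, of h]], of n]
    by (intro measurable_compose[OF \<Gamma> measurable_eval_rooted]) auto
  have "(\<integral>\<^sup>+\<omega>. I h (\<Gamma> \<omega>) \<partial>M) = (\<integral>\<^sup>+\<omega>. J h (\<Gamma> \<omega>) \<partial>M)" if "h \<in> borel_measurable borel" for h
    using that
  proof (induction h rule: borel_measurable_induct)
    case (cong f g)
    then have "f = g" by (auto intro: ext)
    with cong show ?case by simp
  next
    case (set A)
    have "I (indicator A) x = emeasure (root_walk_law n x) (eval_birooted F -` A)"
      and "J (indicator A) x = emeasure (walk_root_law n x) (eval_birooted F -` A)" for x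
      using emeasure_walk_laws[OF F set, of x]
      by (cases "rep_rooted_graph x"; simp add: I_def J_def eval_rooted_def)+
    moreover have "eval_birooted F -` A \<in> sets borel"
      using measurable_sets[OF measurable_eval_birooted[OF F, of borel] set] by simp
    ultimately show ?case
      using rev by (simp add: reversible_def)
  next
    case (mult u c)
    have "I (\<lambda>t. c * u t) x = c * I u x" "J (\<lambda>t. c * u t) x = c * J u x" for x
      by (simp_all add: I_def J_def eval_rooted_def nn_integral_cmult split: prod.splits)
    then show ?case
      using mult.IH I J by (simp add: nn_integral_cmult)
  next
    case (add u v)
    have "I (\<lambda>t. v t + u t) x = I v x + I u x" "J (\<lambda>t. v t + u t) x = J v x + J u x" for x
      by (simp_all add: I_def J_def eval_rooted_def nn_integral_add split: prod.splits)
    then show ?case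
      using add.IH I J by (simp add: nn_integral_add)
  next
    case (seq U)
    have U: "incseq (\<lambda>i v. U i (f v))" for f :: "nat \<Rightarrow> ennreal"
      using \<open>incseq U\<close> by (auto simp: incseq_def le_fun_def)
    have sup: "I (\<Squnion> range U) x = (SUP i. I (U i) x)" "J (\<Squnion> range U) x = (SUP i. J (U i) x)" for x
      by (simp_all add: I_def J_def eval_rooted_def image_comp nn_integral_monotone_convergence_SUP[OF U] split: prod.splits)
    have inc: "incseq (\<lambda>i \<omega>. I (U i) (\<Gamma> \<omega>))" "incseq (\<lambda>i \<omega>. J (U i) (\<Gamma> \<omega>))"
      using \<open>incseq U\<close>
      by (auto simp: incseq_def le_fun_def I_def J_def eval_rooted_def intro!: nn_integral_mono split: prod.splits)
    show ?case
      unfolding sup nn_integral_monotone_convergence_SUP[OF inc(1) I]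
        nn_integral_monotone_convergence_SUP[OF inc(2) J] seq.IH ..
  qed
  from this[of "\<lambda>t. t"] show ?thesis
    by (simp add: I_def J_def)
qed

lemma set_srw_step_edge:
  assumes G: "wf_multigraph G" "locally_finite G" "u \<in> verts G" and "adj G u v"
  shows "v \<in> set_pmf (srw_step G u)"
proof -
  obtain e where e: "e \<in> edges G" "ends G e = {u, v}"
    using assms(4) by (auto simp: adj_def)
  then have ne: "edges_at G u \<noteq> {}"
    by (auto simp: edges_at_def)
  have fin: "finite (edges_at G u)"
    using G by (simp add: locally_finite_def)
  then have "finite {e \<in> edges G. ends G e = {u, v}}"
    by (rule rev_finite_subset) (auto simp: edges_at_def)
  then have "card {e \<in> edges G. ends G e = {u, v}} \<noteq> 0"
    using e by auto
  moreover have "card (edges_at G u) \<noteq> 0"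
    using fin ne by simp
  ultimately show ?thesis
    by (simp add: set_pmf_iff pmf_srw_step[OF G ne])
qed

text \<open>Irreducibility: the walk follows a path from \<open>u\<close> to \<open>w\<close> with
  positive probability, edge by edge.\<close>

lemma srw_pos_reaches:
  assumes G: "conn_lf_multigraph G" "u \<in> verts G" "w \<in> verts G"
  shows "\<exists>n. w \<in> set_pmf (srw_pos G u n)"
proof -
  have wf: "wf_multigraph G" "locally_finite G" and "(adj G)\<^sup>*\<^sup>* u w"
    using G by (auto simp: conn_lf_multigraph_def connected_graph_def)
  from this(3) show ?thesis
  proof (induction rule: rtranclp_induct)
    case base
    have "u \<in> set_pmf (srw_pos G u 0)"
      by (simp add: srw_pos_0)
    then show ?case ..
  next
    case (step v w)
    then obtain n where n: "v \<in> set_pmf (srw_pos G u n)" by blast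
    then have "v \<in> verts G"
      using set_srw_pos[OF wf G(2)] by blast
    then have "w \<in> set_pmf (srw_step G v)"
      using step(2) by (intro set_srw_step_edge wf)
    then have "w \<in> set_pmf (srw_pos G u (Suc n))"
      using n by (auto simp: srw_pos_Suc)
    then show ?case ..
  qed
qed

text \<open>Going to \<open>v\<close> and back in \<open>n\<close> steps each is a return at time
  \<open>2 * n\<close>. The constant \<open>c\<close> will be the truncated \<open>q\<close> at the
  root.\<close>

lemma nn_integral_srw_pos_return:
  "(\<integral>\<^sup>+v. ennreal (pmf (srw_pos G v n) u) * c \<partial>srw_pos G u n) = c * ennreal (pmf (srw_pos G u (2 * n)) u)"
proof -
  have "(\<integral>\<^sup>+v. ennreal (pmf (srw_pos G v n) u) * c \<partial>srw_pos G u n) =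
      (\<integral>\<^sup>+v. ennreal (pmf (srw_pos G v n) u) \<partial>srw_pos G u n) * c"
    by (rule nn_integral_multc) simp
  then show ?thesis
    by (simp add: mult_2 srw_pos_add ennreal_pmf_bind mult.commute[of c])
qed

lemma AE_meet_free_eq_0:
  fixes M :: "'a measure" and \<Gamma> :: "'a \<Rightarrow> rooted_graph"
  assumes M: "prob_space M" and \<Gamma>: "\<Gamma> \<in> borel_measurable M" and rev: "reversible M \<Gamma>"
    and rec: "AE \<omega> in M. recurrent (\<Gamma> \<omega>)"
  shows "AE \<omega> in M. (INF N. eval_rooted (\<lambda>G R. meet_free G N (hd R)) (\<Gamma> \<omega>)) = 0"
proof -
  interpret prob_space M by (rule M)
  define m where "m N \<omega> = eval_rooted (\<lambda>G R. meet_free G N (hd R)) (\<Gamma> \<omega>)" for N \<omega>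
  define p where "p n \<omega> = eval_rooted (\<lambda>G R. ennreal (pmf (srw_pos G (hd R) (2 * n)) (last R))) (\<Gamma> \<omega>)" for n \<omega>
  define q where "q \<omega> = (INF N. m N \<omega>)" for \<omega>
  have m[measurable]: "m N \<in> borel_measurable M" for N
    unfolding m_def by (rule measurable_compose[OF \<Gamma> measurable_eval_rooted[OF local_functional_meet_free]]) simp
  have p[measurable]: "p n \<in> borel_measurable M" for n
    unfolding p_def
    by (rule measurable_compose[OF \<Gamma> measurable_eval_rooted[OF local_functional_comp[OF local_functional_pmf]]]) simp
  have q[measurable]: "q \<in> borel_measurable M"
    unfolding q_def by measurable
  \<comment> \<open>The bound is uniform in \<open>N\<close>, so it survives in the limit of the
    full series.\<close>
  have bound: "(\<integral>\<^sup>+\<omega>. q \<omega> * (\<Sum>n<N. p n \<omega>) \<partial>M) \<le> 1" for N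
  proof -
    \<comment> \<open>By \<open>emeasure_last_meeting\<close>, \<open>L n\<close> is the probability
      that two walks from the root have their last meeting up to time \<open>N\<close> at time
      \<open>n\<close>.\<close>
    define L where "L n = eval_rooted (\<lambda>G R. \<integral>\<^sup>+v. ennreal (pmf (srw_pos G (hd R) n) v) * meet_free G (N - n) v \<partial>srw_pos G (hd R) n)" for n
    let ?F = "\<lambda>n G R. ennreal (pmf (srw_pos G (hd R) n) (last R)) * meet_free G (N - n) (last R)"
    have F: "local_functional (max n (N - n)) (?F n)" for n
    proof (rule local_functional_comp2[where h = "(*)"])
      show "local_functional (max n (N - n)) (\<lambda>G R. ennreal (pmf (srw_pos G (hd R) n) (last R)))"
        by (rule local_functional_comp[where h = ennreal], rule local_functional_mono[OF local_functional_pmf]) simp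
      show "local_functional (max n (N - n)) (\<lambda>G R. meet_free G (N - n) (last R))"
        using local_functional_mono[OF local_functional_rev[OF local_functional_meet_free[of "N - n"]]]
        by (simp add: hd_rev)
    qed
    have Lm[measurable]: "(\<lambda>\<omega>. L n (\<Gamma> \<omega>)) \<in> borel_measurable M" for n
      unfolding L_def using local_functional_integral[OF F[of n], of n]
      by (intro measurable_compose[OF \<Gamma> measurable_eval_rooted]) auto
    have mp: "(\<integral>\<^sup>+\<omega>. m (N - n) \<omega> * p n \<omega> \<partial>M) = (\<integral>\<^sup>+\<omega>. L n (\<Gamma> \<omega>) \<partial>M)" for n
    proof -
      \<comment> \<open>With the roots exchanged, the factor \<open>meet_free\<close> sits at the
        root and leaves the integral; the rest is the return probability.\<close>
      have "m (N - n) \<omega> * p n \<omega> =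
          eval_rooted (\<lambda>G R. \<integral>\<^sup>+v. ?F n G [v, hd R] \<partial>srw_pos G (hd R) n) (\<Gamma> \<omega>)" for \<omega>
        by (simp add: m_def p_def eval_rooted_def nn_integral_srw_pos_return split: prod.splits)
      then show ?thesis
        using reversible_transport[OF \<Gamma> rev F[of n], of n] by (simp add: L_def)
    qed
    have "(\<integral>\<^sup>+\<omega>. q \<omega> * (\<Sum>n<N. p n \<omega>) \<partial>M) \<le> (\<integral>\<^sup>+\<omega>. (\<Sum>n\<le>N. m (N - n) \<omega> * p n \<omega>) \<partial>M)"
    proof (rule nn_integral_mono)
      fix \<omega>
      have "q \<omega> * (\<Sum>n<N. p n \<omega>) = (\<Sum>n<N. q \<omega> * p n \<omega>)"
        by (rule sum_distrib_left)
      \<comment> \<open>The limit \<open>q\<close> lies below every truncation, so a different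
        truncation can be used for each \<open>n\<close>.\<close>
      also have "\<dots> \<le> (\<Sum>n<N. m (N - n) \<omega> * p n \<omega>)"
        unfolding q_def by (intro sum_mono mult_right_mono INF_lower) auto
      also have "\<dots> \<le> (\<Sum>n\<le>N. m (N - n) \<omega> * p n \<omega>)"
        by (intro sum_mono2) auto
      finally show "q \<omega> * (\<Sum>n<N. p n \<omega>) \<le> (\<Sum>n\<le>N. m (N - n) \<omega> * p n \<omega>)" .
    qed
    also have "\<dots> = (\<Sum>n\<le>N. \<integral>\<^sup>+\<omega>. L n (\<Gamma> \<omega>) \<partial>M)"
      by (subst nn_integral_sum) (simp_all add: mp)
    also have "\<dots> = (\<integral>\<^sup>+\<omega>. (\<Sum>n\<le>N. L n (\<Gamma> \<omega>)) \<partial>M)"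
      by (subst nn_integral_sum) simp_all
    also have "\<dots> \<le> (\<integral>\<^sup>+\<omega>. 1 \<partial>M)"
    proof (rule nn_integral_mono)
      fix \<omega>
      show "(\<Sum>n\<le>N. L n (\<Gamma> \<omega>)) \<le> 1"
        using sum_last_meeting_le_1
        by (cases "rep_rooted_graph (\<Gamma> \<omega>)") (simp add: L_def eval_rooted_def)
    qed
    finally show ?thesis
      by (simp add: emeasure_space_1)
  qed
  have "(\<integral>\<^sup>+\<omega>. q \<omega> * (\<Sum>n. p n \<omega>) \<partial>M) = (\<integral>\<^sup>+\<omega>. (SUP N. q \<omega> * (\<Sum>n<N. p n \<omega>)) \<partial>M)"
    by (simp add: suminf_eq_SUP SUP_mult_left_ennreal)
  also have "\<dots> = (SUP N. \<integral>\<^sup>+\<omega>. q \<omega> * (\<Sum>n<N. p n \<omega>) \<partial>M)"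
    by (intro nn_integral_monotone_convergence_SUP)
       (auto simp: incseq_def le_fun_def intro!: mult_left_mono sum_mono2)
  also have "\<dots> \<le> 1"
    by (intro SUP_least bound)
  finally have "(\<integral>\<^sup>+\<omega>. q \<omega> * (\<Sum>n. p n \<omega>) \<partial>M) \<noteq> \<infinity>"
    by (auto simp: top_unique)
  \<comment> \<open>A product with an infinite factor can be finite only if the other factor is
    0.\<close>
  then have "AE \<omega> in M. q \<omega> * (\<Sum>n. p n \<omega>) \<noteq> \<infinity>"
    by (intro nn_integral_noteq_infinite) measurable
  then have "AE \<omega> in M. q \<omega> = 0"
    using rec
  proof eventually_elim
    case (elim \<omega>)
    obtain G u where x: "rep_rooted_graph (\<Gamma> \<omega>) = (G, u)"
      by (metis prod.exhaust)
    then have "recurrent_graph G" "u \<in> verts G"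
      using elim(2) rep_rooted_graph[OF x] by (auto simp: recurrent.rep_eq)
    then have "(\<Sum>n. p n \<omega>) = \<infinity>"
      using recurrent_suminf_even by (simp add: p_def eval_rooted_def x)
    with elim(1) show ?case
      by (auto simp: ennreal_mult_eq_top_iff)
  qed
  then show ?thesis
    by (simp add: q_def m_def)
qed

theorem theorem1:
  fixes M :: "'a measure" and \<Gamma> :: "'a \<Rightarrow> rooted_graph"
  assumes "prob_space M"
    and "\<Gamma> \<in> borel_measurable M"
    and "reversible M \<Gamma>"
    and "AE \<omega> in M. recurrent (\<Gamma> \<omega>)"
    and "AE \<omega> in M. infinite_graph (\<Gamma> \<omega>)"
  shows "AE \<omega> in M. infinite_collision (\<Gamma> \<omega>)"
proof -
  interpret prob_space M by (rule assms(1))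
  note \<Gamma> = assms(2)
  define m where "m N \<omega> = eval_rooted (\<lambda>G R. meet_free G N (hd R)) (\<Gamma> \<omega>)" for N \<omega>
  \<comment> \<open>The average of the truncated \<open>q\<close> over the position of the walk at
    time \<open>n\<close>.\<close>
  define s where "s n N \<omega> = eval_rooted (\<lambda>G R. \<integral>\<^sup>+v. meet_free G N v \<partial>srw_pos G (hd R) n) (\<Gamma> \<omega>)" for n N \<omega>
  have m: "m N \<in> borel_measurable M" for N
    unfolding m_def by (rule measurable_compose[OF \<Gamma> measurable_eval_rooted[OF local_functional_meet_free]]) simp
  have last: "local_functional N (\<lambda>G R. meet_free G N (last R))" for N
    using local_functional_rev[OF local_functional_meet_free[of N]] by (simp add: hd_rev)
  have s[measurable]: "s n N \<in> borel_measurable M" for n N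
    unfolding s_def using local_functional_integral[OF last[of N], of n]
    by (intro measurable_compose[OF \<Gamma> measurable_eval_rooted]) auto
  have stationary: "(\<integral>\<^sup>+\<omega>. s n N \<omega> \<partial>M) = (\<integral>\<^sup>+\<omega>. m N \<omega> \<partial>M)" for n N
  proof -
    \<comment> \<open>Transport of a functional of the second root alone: after the exchange it no
      longer depends on \<open>v\<close> and integrates to its value at the root.\<close>
    have "m N \<omega> = eval_rooted (\<lambda>G R. \<integral>\<^sup>+v. meet_free G N (last [v, hd R]) \<partial>srw_pos G (hd R) n) (\<Gamma> \<omega>)" for \<omega>
      by (simp add: m_def eval_rooted_def measure_pmf.emeasure_space_1 split: prod.splits)
    then show ?thesis
      using reversible_transport[OF \<Gamma> assms(3) last[of N], of n] by (simp add: s_def)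
  qed
  have "(INF N. \<integral>\<^sup>+\<omega>. m N \<omega> \<partial>M) = (\<integral>\<^sup>+\<omega>. (INF N. m N \<omega>) \<partial>M)"
  proof (rule nn_integral_monotone_convergence_INF_decseq[symmetric, where i = 0])
    show "decseq m"
      by (intro antimonoI le_funI) (simp add: m_def eval_rooted_def meet_free_antimono split: prod.splits)
    have "(\<integral>\<^sup>+\<omega>. m 0 \<omega> \<partial>M) \<le> (\<integral>\<^sup>+\<omega>. 1 \<partial>M)"
      by (intro nn_integral_mono) (auto simp: m_def eval_rooted_def intro: meet_free_le_1 split: prod.splits)
    also have "\<dots> < \<infinity>"
      by (simp add: emeasure_space_1)
    finally show "(\<integral>\<^sup>+\<omega>. m 0 \<omega> \<partial>M) < \<infinity>" .
  qed (rule m)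
  also have "\<dots> = (\<integral>\<^sup>+\<omega>. 0 \<partial>M)"
    using AE_meet_free_eq_0[OF assms(1-4)] by (intro nn_integral_cong_AE) (simp add: m_def)
  finally have INF_m: "(INF N. \<integral>\<^sup>+\<omega>. m N \<omega> \<partial>M) = 0" by simp
  have "AE \<omega> in M. (INF N. s n N \<omega>) = 0" for n
  proof -
    \<comment> \<open>The expectation of \<open>s n N\<close> equals that of \<open>m N\<close>,
      whose infimum over \<open>N\<close> is 0.\<close>
    have "(\<integral>\<^sup>+\<omega>. (INF N. s n N \<omega>) \<partial>M) \<le> (INF N. \<integral>\<^sup>+\<omega>. s n N \<omega> \<partial>M)"
      by (intro INF_greatest nn_integral_mono INF_lower) auto
    then have "(\<integral>\<^sup>+\<omega>. (INF N. s n N \<omega>) \<partial>M) = 0"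
      by (simp add: stationary INF_m)
    then show ?thesis
      by (subst (asm) nn_integral_0_iff_AE) measurable
  qed
  then have "AE \<omega> in M. \<forall>n. (INF N. s n N \<omega>) = 0"
    by (subst AE_all_countable) blast
  then show ?thesis
  proof eventually_elim
    case (elim \<omega>)
    obtain G u where x: "rep_rooted_graph (\<Gamma> \<omega>) = (G, u)"
      by (metis prod.exhaust)
    note G = rep_rooted_graph[OF x]
    have "collision_graph G"
    proof (rule collision_graphI)
      show "wf_multigraph G" "locally_finite G"
        using G by (auto simp: conn_lf_multigraph_def)
      fix w assume "w \<in> verts G"
      then obtain n where n: "w \<in> set_pmf (srw_pos G u n)"
        using srw_pos_reaches[OF G] by blast
      \<comment> \<open>The average \<open>s n N\<close> dominates its contribution from
        \<open>w\<close>, which has positive weight. As \<open>s n N\<close> has infimum 0,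
        \<open>q\<close> must vanish at \<open>w\<close>.\<close>
      have "ennreal (pmf (srw_pos G u n) w) * (INF N. meet_free G N w) \<le> s n N \<omega>" for N
      proof -
        have "ennreal (pmf (srw_pos G u n) w) * (INF N. meet_free G N w) \<le> meet_free G N w * ennreal (pmf (srw_pos G u n) w)"
          by (subst mult.commute) (intro mult_right_mono INF_lower; simp)
        also have "\<dots> = (\<integral>\<^sup>+v. meet_free G N v * indicator {w} v \<partial>srw_pos G u n)"
          by (subst nn_integral_indicator_singleton) (simp_all add: emeasure_pmf_single)
        also have "\<dots> \<le> (\<integral>\<^sup>+v. meet_free G N v \<partial>srw_pos G u n)"
          by (intro nn_integral_mono) (simp split: split_indicator)
        finally show ?thesis
          by (simp add: s_def eval_rooted_def x)
      qed
      then have "ennreal (pmf (srw_pos G u n) w) * (INF N. meet_free G N w) \<le> (INF N. s n N \<omega>)"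
        by (rule INF_greatest)
      then show "(INF N. meet_free G N w) = 0"
        using n elim by (simp add: set_pmf_iff)
    qed
    then show ?case
      by (simp add: infinite_collision.rep_eq x)
  qed
qed

end
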